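(* Let $n,\ell,m_x,m_y$ be positive integers and $\mathbb{Q}\subset\mathbb{R}^\ell$. Consider either of the following settings. (LMI setting) $F_0,\dots,F_{m_x}:\mathbb{Q}\to\mathbb{R}^{n\times n}$ take values in real symmetric matrices, $m_\theta=m_x$, $\theta=x\in\mathbb{R}^{m_x}$, $F(\theta,q)=F_0(q)+\sum_{i=1}^{m_x}x_iF_i(q)$. (BMI setting) $F_0,F_i,G_j,H_{ij}:\mathbb{Q}\to\mathbb{R}^{n\times n}$ ($i=1,\dots,m_x$, $j=1,\dots,m_y$) take values in real symmetric matrices, $m_\theta=m_x+m_y$, $\theta=(x,y)\in\mathbb{R}^{m_x}\times\mathbb{R}^{m_y}$, $F(\theta,q)=F_0(q)+\sum_i x_iF_i(q)+\sum_j y_jG_j(q)+\sum_{i,j}x_iy_jH_{ij}(q)$. Define $g:\mathbb{R}^{m_\theta}\times\mathbb{Q}\to\{0,1\}$ by $g(\theta,q)=0$ if $F(\theta,q)\succeq0$ (positive semidefinite) and $g(\theta,q)=1$ otherwise. Then the VC-dimension $d$ of the family $\{g(\theta,\cdot):\theta\in\mathbb{R}^{m_\theta}\}$ satisfies $$d\le 2m_\theta\log_2\!\left(4en2^n\right),$$ where $e$ is Euler's number.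
   Context: For a family $\mathcal{G}$ of functions $\mathbb{Q}\to\{0,1\}$, a finite set $\{q^{(1)},\dots,q^{(N)}\}\subset\mathbb{Q}$ is shattered by $\mathcal{G}$ if for every subset $S$ of it there is $h\in\mathcal{G}$ with $\{q^{(i)}:h(q^{(i)})=1\}=S$. The VC-dimension of $\mathcal{G}$ is the largest integer $d$ such that some set of $d$ points of $\mathbb{Q}$ is shattered by $\mathcal{G}$. *)

theory Defs
  imports "HOL-Analysis.Analysis" "HOL-Library.Extended_Nat"
begin

definition shattered_by :: "('a \<Rightarrow> nat) set \<Rightarrow> 'a set \<Rightarrow> 'a set \<Rightarrow> bool" where
  "shattered_by G Q S \<longleftrightarrow> S \<subseteq> Q \<and> finite S \<and>
     (\<forall>T. T \<subseteq> S \<longrightarrow> (\<exists>h\<in>G. {q\<in>S. h q = 1} = T))"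

definition VC_dim :: "('a \<Rightarrow> nat) set \<Rightarrow> 'a set \<Rightarrow> enat" where
  "VC_dim G Q = Sup {enat (card S) | S. shattered_by G Q S}"

definition sym_mat :: "real^'n^'n \<Rightarrow> bool" where
  "sym_mat A \<longleftrightarrow> transpose A = A"

definition psd :: "real^'n^'n \<Rightarrow> bool" where
  "psd A \<longleftrightarrow> (\<forall>v. 0 \<le> v \<bullet> (A *v v))"

definition lmi_F :: "('q \<Rightarrow> real^'n^'n) \<Rightarrow> ('i::finite \<Rightarrow> 'q \<Rightarrow> real^'n^'n)
    \<Rightarrow> real^'i \<Rightarrow> 'q \<Rightarrow> real^'n^'n" where
  "lmi_F F0 Fs x q = F0 q + (\<Sum>i\<in>UNIV. (x $ i) *\<^sub>R Fs i q)"

definition bmi_F :: "('q \<Rightarrow> real^'n^'n) \<Rightarrow> ('i::finite \<Rightarrow> 'q \<Rightarrow> real^'n^'n)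
    \<Rightarrow> ('j::finite \<Rightarrow> 'q \<Rightarrow> real^'n^'n) \<Rightarrow> ('i \<Rightarrow> 'j \<Rightarrow> 'q \<Rightarrow> real^'n^'n)
    \<Rightarrow> real^'i \<Rightarrow> real^'j \<Rightarrow> 'q \<Rightarrow> real^'n^'n" where
  "bmi_F F0 Fs Gs Hs x y q = F0 q + (\<Sum>i\<in>UNIV. (x $ i) *\<^sub>R Fs i q)
      + (\<Sum>j\<in>UNIV. (y $ j) *\<^sub>R Gs j q)
      + (\<Sum>i\<in>UNIV. \<Sum>j\<in>UNIV. (x $ i * y $ j) *\<^sub>R Hs i j q)"

definition psd_indicator :: "real^'n^'n \<Rightarrow> nat" where
  "psd_indicator A = (if psd A then 0 else 1)"

end

theory Submission
  imports Defs
begin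

text \<open>Up to an arbitrarily small shift by a multiple of the identity, semidefiniteness of
  \<open>F(\<theta>, q)\<close> at finitely many parameters is decided by Sylvester's criterion, that is by the signs
  of \<open>n\<close> polynomials in \<open>\<theta>\<close> of degree at most \<open>2 n\<close>. Taking \<open>n\<close>
  leading minors instead of all \<open>2 ^ n\<close> principal ones leaves room in the bound for the degree \<open>2 n\<close>
  of the bilinear case. So a shattered set of \<open>d\<close> points produces \<open>2 ^ d\<close> sign patterns of \<open>n d\<close> polynomials in
  \<open>m\<close> variables, and a count in the style of Warren bounds their number by
  \<open>(4 n + 1) ^ m * (\<Sum>k\<le>m. (n d choose k) * 2 ^ k)\<close>.

  For the count, every cell \<open>{x. \<sigma>\<^sub>i f\<^sub>i x > 0}\<close> is shrunk to \<open>{x. \<sigma>\<^sub>i f\<^sub>i x \<ge> \<epsilon>\<^sub>i}\<close> with generic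
  thresholds, so that at most \<open>m\<close> constraints are tight at any point. With \<open>A\<close> a maximal set of
  simultaneously tight constraints, \<open>(\<Sum>i\<in>A. (\<sigma>\<^sub>i f\<^sub>i x - \<epsilon>\<^sub>i)\<^sup>2) + \<eta> * (\<Sum>j. x\<^sub>j ^ (2 \<delta> + 2))\<close> has for small
  \<open>\<eta>\<close> a local minimum inside the cell. Its critical equations have pure powers as leading forms, so
  an elementary case of Bezout's theorem bounds the number of minima for each of the
  \<open>\<Sum>k\<le>m. (n d choose k) * 2 ^ k\<close> possible choices of \<open>A\<close> and of the signs on it.\<close>

section \<open>Polynomial functions of bounded degree\<close>

text \<open>Gaussian elimination: an equation without nonzero coefficient is dropped, any other is
  solved for a pivot \<open>x0\<close>. It supplies the dependences behind both the Bezout bound and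
  Kronecker's substitution.\<close>

lemma underdetermined_system:
  fixes v :: "'a \<Rightarrow> 'b \<Rightarrow> real"
  assumes "finite B" "finite X" "card B < card X"
  shows "\<exists>c. (\<exists>x\<in>X. c x \<noteq> 0) \<and> (\<forall>b\<in>B. (\<Sum>x\<in>X. c x * v x b) = 0)"
  using assms
proof (induction B arbitrary: X v rule: finite_induct)
  case empty
  then have "X \<noteq> {}" by auto
  then show ?case by (intro exI[of _ "\<lambda>_. 1"]) auto
next
  case (insert b B)
  show ?case
  proof (cases "\<forall>x\<in>X. v x b = 0")
    case True
    have "card B < card X" using insert by simp
    from insert.IH[OF insert.prems(1) this, of v] True show ?thesis by auto
  next
    case False
    then obtain x0 where x0: "x0 \<in> X" "v x0 b \<noteq> 0" by auto
    let ?X = "X - {x0}"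
    \<comment> \<open>Entry \<open>b\<close> of each vector is cleared with the pivot vector;
      \<open>s\<close> below is then the amount of the pivot that equation \<open>b\<close>
      demands.\<close>
    let ?w = "\<lambda>x b'. v x b' - v x b / v x0 b * v x0 b'"
    have "card B < card ?X" using insert x0 by simp
    from insert.IH[OF _ this, of ?w] insert.prems obtain c
      where c: "\<exists>x\<in>?X. c x \<noteq> 0" "\<And>b'. b' \<in> B \<Longrightarrow> (\<Sum>x\<in>?X. c x * ?w x b') = 0"
      by auto
    define s where "s = (\<Sum>x\<in>?X. c x * v x b) / v x0 b"
    define c' where "c' = c(x0 := - s)"
    have split: "(\<Sum>x\<in>X. c' x * v x b') = (\<Sum>x\<in>?X. c x * v x b') - s * v x0 b'" for b'
    proof -
      have "(\<Sum>x\<in>X. c' x * v x b') = c' x0 * v x0 b' + (\<Sum>x\<in>?X. c' x * v x b')"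
        using x0 insert.prems by (simp add: sum.remove)
      also have "(\<Sum>x\<in>?X. c' x * v x b') = (\<Sum>x\<in>?X. c x * v x b')"
        by (intro sum.cong) (auto simp: c'_def)
      finally show ?thesis by (simp add: c'_def)
    qed
    have "(\<Sum>x\<in>X. c' x * v x b) = 0"
      unfolding split using x0 by (simp add: s_def)
    moreover have "(\<Sum>x\<in>X. c' x * v x b') = 0" if "b' \<in> B" for b'
    proof -
      have "(\<Sum>x\<in>?X. c x * ?w x b') = (\<Sum>x\<in>?X. c x * v x b') - s * v x0 b'"
        by (simp add: s_def algebra_simps sum_subtractf sum_distrib_left sum_distrib_right
            sum_divide_distrib)
      with c(2)[OF that] show ?thesis unfolding split by simp
    qed
    moreover have "\<exists>x\<in>X. c' x \<noteq> 0" using c(1) by (auto simp: c'_def)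
    ultimately show ?thesis by blast
  qed
qed

text \<open>Polynomials are kept as functions, with \<open>k\<close> an upper bound for the total
  degree. Multiplying by one coordinate at a time keeps inductions short; general products are
  derived.\<close>

inductive poly_deg_le :: "nat \<Rightarrow> (real^'m::finite \<Rightarrow> real) \<Rightarrow> bool" where
  const: "poly_deg_le k (\<lambda>x. c)"
| add: "poly_deg_le k f \<Longrightarrow> poly_deg_le k g \<Longrightarrow> poly_deg_le k (\<lambda>x. f x + g x)"
| var_mult: "poly_deg_le k f \<Longrightarrow> poly_deg_le (Suc k) (\<lambda>x. x $ j * f x)"

lemma poly_deg_le_mono: "poly_deg_le k f \<Longrightarrow> k \<le> l \<Longrightarrow> poly_deg_le l f"
proof (induction arbitrary: l rule: poly_deg_le.induct)
  case (var_mult k f j)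
  then obtain l' where "l = Suc l'" "k \<le> l'" by (cases l) auto
  then show ?case using var_mult.IH poly_deg_le.var_mult by blast
qed (auto intro: poly_deg_le.intros)

lemma poly_deg_le_cmult: "poly_deg_le k f \<Longrightarrow> poly_deg_le k (\<lambda>x. a * f x)"
proof (induction rule: poly_deg_le.induct)
  case (add k f g)
  then show ?case using poly_deg_le.add[OF add.IH] by (simp add: algebra_simps)
next
  case (var_mult k f j)
  then show ?case using poly_deg_le.var_mult[OF var_mult.IH, of j] by (simp add: algebra_simps)
qed (rule poly_deg_le.const)

lemma poly_deg_le_mult:
  "poly_deg_le k f \<Longrightarrow> poly_deg_le l g \<Longrightarrow> poly_deg_le (k + l) (\<lambda>x. f x * g x)"
proof (induction rule: poly_deg_le.induct)
  case (const k c)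
  then show ?case by (intro poly_deg_le_mono[OF poly_deg_le_cmult]) auto
next
  case (add k f g')
  then show ?case using poly_deg_le.add[of "k+l" "\<lambda>x. f x * g x" "\<lambda>x. g' x * g x"]
    by (simp add: algebra_simps)
next
  case (var_mult k f j)
  then show ?case using poly_deg_le.var_mult[of "k+l" "\<lambda>x. f x * g x" j]
    by (simp add: algebra_simps)
qed

lemma poly_deg_le_var: "poly_deg_le 1 (\<lambda>x. x $ j)"
  using poly_deg_le.var_mult[OF poly_deg_le.const[of 0 1], of j] by simp

lemma poly_deg_le_sum:
  "(\<And>i. i \<in> I \<Longrightarrow> poly_deg_le k (f i)) \<Longrightarrow> poly_deg_le k (\<lambda>x. \<Sum>i\<in>I. f i x)"
  by (induction I rule: infinite_finite_induct) (auto intro: poly_deg_le.intros)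

lemma poly_deg_le_diff_const: "poly_deg_le k f \<Longrightarrow> poly_deg_le k (\<lambda>x. f x - c)"
  using poly_deg_le.add[OF _ poly_deg_le.const[of k "- c"], of f] by simp

lemma poly_deg_le_prod:
  "(\<And>i. i \<in> I \<Longrightarrow> poly_deg_le (k i) (f i)) \<Longrightarrow> poly_deg_le (\<Sum>i\<in>I. k i) (\<lambda>x. \<Prod>i\<in>I. f i x)"
  by (induction I rule: infinite_finite_induct) (auto intro: poly_deg_le.const poly_deg_le_mult)

lemma poly_deg_le_power: "poly_deg_le k f \<Longrightarrow> poly_deg_le (n * k) (\<lambda>x. f x ^ n)"
  by (induction n) (auto intro: poly_deg_le.const poly_deg_le_mult)

text \<open>The bound stays \<open>k\<close>, which avoids truncated subtraction and is sharp enough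
  later, where partial derivatives are compared with powers of exponent
  \<open>k + 1\<close>.\<close>

lemma poly_deg_le_deriv:
  fixes f :: "real^'m::finite \<Rightarrow> real"
  assumes "poly_deg_le k f"
  shows "\<exists>D. \<forall>x. (f has_derivative (\<lambda>h. \<Sum>i\<in>UNIV. D i x * h $ i)) (at x) \<and> (\<forall>i. poly_deg_le k (D i))"
  using assms
proof (induction rule: poly_deg_le.induct)
  case (const k c)
  show ?case by (intro exI[of _ "\<lambda>_ _. 0"]) (auto intro: poly_deg_le.const)
next
  case (add k f g)
  then obtain D E where
    "\<And>x. (f has_derivative (\<lambda>h. \<Sum>i\<in>UNIV. D i x * h $ i)) (at x)" "\<And>i. poly_deg_le k (D i)"
    "\<And>x. (g has_derivative (\<lambda>h. \<Sum>i\<in>UNIV. E i x * h $ i)) (at x)" "\<And>i. poly_deg_le k (E i)"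
    by blast
  note * = this
  show ?case
  proof (intro exI[of _ "\<lambda>i x. D i x + E i x"] allI conjI)
    fix x
    show "((\<lambda>x. f x + g x) has_derivative (\<lambda>h. \<Sum>i\<in>UNIV. (D i x + E i x) * h $ i)) (at x)"
      by (rule has_derivative_eq_rhs, rule has_derivative_add[OF *(1) *(3)])
        (simp add: algebra_simps sum.distrib)
  qed (use * in \<open>auto intro: poly_deg_le.add\<close>)
next
  case (var_mult k f j)
  then obtain D where
    D: "\<And>x. (f has_derivative (\<lambda>h. \<Sum>i\<in>UNIV. D i x * h $ i)) (at x)" "\<And>i. poly_deg_le k (D i)"
    by blast
  show ?case
  proof (intro exI[of _ "\<lambda>i x. x $ j * D i x + (if i = j then 1 else 0) * f x"] allI conjI)
    fix x
    have "((\<lambda>x. x $ j * f x) has_derivative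
        (\<lambda>h. x $ j * (\<Sum>i\<in>UNIV. D i x * h $ i) + h $ j * f x)) (at x)"
      by (rule has_derivative_mult[OF _ D(1)])
        (intro bounded_linear_imp_has_derivative bounded_linear_vec_nth)
    then show "((\<lambda>x. x $ j * f x) has_derivative
        (\<lambda>h. \<Sum>i\<in>UNIV. (x $ j * D i x + (if i = j then 1 else 0) * f x) * h $ i)) (at x)"
    proof (rule has_derivative_eq_rhs, intro ext)
      fix h :: "real^'m"
      show "x $ j * (\<Sum>i\<in>UNIV. D i x * h $ i) + h $ j * f x
        = (\<Sum>i\<in>UNIV. (x $ j * D i x + (if i = j then 1 else 0) * f x) * h $ i)"
      by (simp add: algebra_simps sum.distrib sum_distrib_left if_distrib[of "\<lambda>t. t * _"]
          if_distrib[of "\<lambda>t. _ * t"] cong: if_cong)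
    qed
  next
    fix i
    show "poly_deg_le (Suc k) (\<lambda>x. x $ j * D i x + (if i = j then 1 else 0) * f x)"
      by (intro poly_deg_le.add poly_deg_le.var_mult D poly_deg_le_cmult
          poly_deg_le_mono[OF var_mult.hyps]) auto
  qed
qed

lemma continuous_on_poly_deg_le: "poly_deg_le k f \<Longrightarrow> continuous_on S f"
  by (induction rule: poly_deg_le.induct) (auto intro!: continuous_intros)

section \<open>Monomials and a Bezout bound for systems with pure leading powers\<close>

abbreviation monomial :: "('m::finite \<Rightarrow> nat) \<Rightarrow> real^'m \<Rightarrow> real" where
  "monomial a x \<equiv> \<Prod>j\<in>UNIV. (x $ j) ^ a j"

lemma monomial_fun_upd:
  "monomial (a(j := a j + n)) x = (x $ j) ^ n * monomial a x"
proof -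
  have "monomial (a(j := a j + n)) x = x $ j ^ (a j + n) * (\<Prod>i\<in>UNIV - {j}. x $ i ^ (a(j := a j + n)) i)"
    by (subst prod.remove[of _ j]) auto
  also have "(\<Prod>i\<in>UNIV - {j}. x $ i ^ (a(j := a j + n)) i) = (\<Prod>i\<in>UNIV - {j}. x $ i ^ a i)"
    by (intro prod.cong) auto
  also have "x $ j ^ (a j + n) * \<dots> = (x $ j) ^ n * monomial a x"
    by (subst (2) prod.remove[of _ j]) (auto simp: power_add)
  finally show ?thesis .
qed

lemma sum_fun_upd_add:
  fixes a :: "'m::finite \<Rightarrow> nat"
  shows "(\<Sum>i\<in>UNIV. (a(j := a j + n)) i) = (\<Sum>i\<in>UNIV. a i) + n"
  by (simp add: sum.remove[of UNIV j])

text \<open>The factor \<open>monomial b\<close> collects the coordinates stripped off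
  \<open>f\<close>, so the induction ends at single monomials of degree at most
  \<open>n\<close>.\<close>

lemma sum_mono_zero_imp_sum_poly_zero:
  assumes "\<And>a. (\<Sum>j\<in>UNIV. a j) \<le> n \<Longrightarrow> (\<Sum>x\<in>X. c x * monomial a x) = 0"
    and "poly_deg_le k f" "(\<Sum>j\<in>UNIV. b j) + k \<le> n"
  shows "(\<Sum>x\<in>X. c x * (monomial b x * f x)) = (0::real)"
  using assms(2,3)
proof (induction arbitrary: b rule: poly_deg_le.induct)
  case (const k d)
  then have "(\<Sum>x\<in>X. c x * monomial b x) = 0" using assms(1) by auto
  then have "(\<Sum>x\<in>X. c x * monomial b x) * d = 0" by simp
  then show ?case by (simp add: sum_distrib_right mult.assoc)
next
  case (add k f g)
  then show ?case by (simp add: algebra_simps sum.distrib)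
next
  case (var_mult k f j)
  have "(\<Sum>x\<in>X. c x * (monomial (b(j := b j + 1)) x * f x)) = 0"
    by (rule var_mult.IH) (use var_mult.prems sum_fun_upd_add[of b j 1] in auto)
  then show ?case by (simp only: monomial_fun_upd power_one_right) (simp add: ac_simps)
qed

text \<open>Bezout's bound for a system whose leading forms are pure powers: modulo the system the
  monomials with all exponents at most \<open>k\<close> span, whereas distinct points are linearly independent
  as functionals.\<close>

lemma card_solutions_le:
  fixes X :: "(real^'m::finite) set"
  assumes fin: "finite X" and g: "\<And>j. poly_deg_le k (g j)"
    and eq: "\<And>x j. x \<in> X \<Longrightarrow> (x $ j) ^ (k + 1) = g j x"
  shows "card X \<le> (k + 1) ^ CARD('m)"
proof (rule ccontr)
  assume "\<not> ?thesis"
  moreover define B where "B = PiE (UNIV :: 'm set) (\<lambda>_. {..k})"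
  ultimately have "card B < card X" by (simp add: B_def card_PiE)
  moreover have "finite B" by (auto simp: B_def intro: finite_PiE)
  ultimately obtain c where c: "\<exists>x\<in>X. c x \<noteq> 0" "\<And>a. a \<in> B \<Longrightarrow> (\<Sum>x\<in>X. c x * monomial a x) = 0"
    using underdetermined_system[of B X "\<lambda>x a. monomial a x"] fin by auto
  \<comment> \<open>Induction on the total degree: an exponent above \<open>k\<close> in coordinate
    \<open>j\<close> lets \<open>g j\<close> replace the power \<open>k + 1\<close>, and only
    monomials of smaller degree arise.\<close>
  have mono0: "(\<Sum>x\<in>X. c x * monomial a x) = 0" for a
  proof (induction "\<Sum>j\<in>UNIV. a j" arbitrary: a rule: less_induct)
    case less
    show ?case
    proof (cases "a \<in> B")
      case False
      then obtain j where j: "a j > k" by (auto simp: B_def PiE_def) (meson not_le)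
      define b where "b = a(j := a j - (k + 1))"
      have a: "a = b(j := b j + (k + 1))" using j by (auto simp: b_def)
      have "(\<Sum>x\<in>X. c x * (monomial b x * g j x)) = 0"
      proof (rule sum_mono_zero_imp_sum_poly_zero[OF _ g, where n = "(\<Sum>i\<in>UNIV. b i) + k"])
        fix a' :: "'m \<Rightarrow> nat"
        assume "(\<Sum>j\<in>UNIV. a' j) \<le> (\<Sum>i\<in>UNIV. b i) + k"
        also have "\<dots> < (\<Sum>i\<in>UNIV. a i)" by (subst a) (simp only: sum_fun_upd_add)
        finally show "(\<Sum>x\<in>X. c x * monomial a' x) = 0" by (rule less)
      qed simp
      moreover have "monomial a x = monomial b x * g j x" if "x \<in> X" for x
        by (subst a) (simp only: monomial_fun_upd eq[OF that] mult.commute)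
      ultimately show ?thesis by simp
    qed (rule c)
  qed
  obtain x0 where x0: "x0 \<in> X" "c x0 \<noteq> 0" using c(1) by auto
  \<comment> \<open>The product of squared distances vanishes at all other points of
    \<open>X\<close> but not at \<open>x0\<close>, so it isolates the weight
    \<open>c x0\<close>.\<close>
  define f where "f = (\<lambda>x::real^'m. \<Prod>y\<in>X - {x0}. \<Sum>j\<in>UNIV. (x $ j - y $ j) ^ 2)"
  have f: "poly_deg_le (\<Sum>y\<in>X - {x0}. 2 * 1) f"
    unfolding f_def
    by (intro poly_deg_le_prod poly_deg_le_sum poly_deg_le_power poly_deg_le_diff_const poly_deg_le_var)
  have "(\<Sum>x\<in>X. c x * (monomial (\<lambda>_. 0) x * f x)) = 0"
    by (rule sum_mono_zero_imp_sum_poly_zero[OF mono0 f order.refl])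
  moreover have "f x = 0" if "x \<in> X - {x0}" for x
    unfolding f_def using that fin by (intro prod_zero bexI[of _ x]) auto
  ultimately have "c x0 * f x0 = 0"
    using fin x0 by (simp add: sum.remove[of X x0])
  moreover have "f x0 \<noteq> 0"
    using fin by (auto simp: f_def sum_nonneg_eq_0_iff vec_eq_iff)
  ultimately show False using x0 by simp
qed

section \<open>Counting sign patterns\<close>

text \<open>Exponents range over a box rather than a simplex, so that their number is a plain
  power.\<close>

lemma poly_deg_le_expansion:
  fixes f :: "real^'m::finite \<Rightarrow> real"
  assumes "poly_deg_le k f"
  shows "\<exists>v. \<forall>x. f x = (\<Sum>b\<in>PiE (UNIV :: 'm set) (\<lambda>_. {..k}). v b * monomial b x)"
  using assms
proof (induction rule: poly_deg_le.induct)
  case (const k c)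
  have "c = (\<Sum>b\<in>PiE (UNIV :: 'm set) (\<lambda>_. {..k}). (if b = (\<lambda>_. 0) then c else 0) * monomial b x)" for x
  proof -
    have "finite (PiE (UNIV :: 'm set) (\<lambda>_. {..k}))" "(\<lambda>_. 0) \<in> PiE (UNIV :: 'm set) (\<lambda>_. {..k})"
      by (auto intro: finite_PiE)
    then show ?thesis by (subst if_distrib[of "\<lambda>t. t * _"]) (simp cong: if_cong)
  qed
  then show ?case by (intro exI[of _ "\<lambda>b. if b = (\<lambda>_. 0) then c else 0"]) blast
next
  case (add k f g)
  then obtain v w where
    "\<forall>x. f x = (\<Sum>b\<in>PiE UNIV (\<lambda>_. {..k}). v b * monomial b x)"
    "\<forall>x. g x = (\<Sum>b\<in>PiE UNIV (\<lambda>_. {..k}). w b * monomial b x)" by blast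
  then show ?case by (intro exI[of _ "\<lambda>b. v b + w b"]) (simp add: algebra_simps sum.distrib)
next
  case (var_mult k f j)
  let ?B = "\<lambda>k::nat. PiE (UNIV :: 'm set) (\<lambda>_. {..k})"
  from var_mult obtain v where v: "\<And>x. f x = (\<Sum>b\<in>?B k. v b * monomial b x)" by blast
  define s where "s = (\<lambda>b :: 'm \<Rightarrow> nat. b(j := b j + 1))"
  define r where "r = (\<lambda>b :: 'm \<Rightarrow> nat. b(j := b j - 1))"
  have fin: "finite (?B k)" for k by (rule finite_PiE) auto
  have rs: "r (s b) = b" for b by (auto simp: r_def s_def)
  have inj: "inj_on s A" for A by (metis inj_onI rs)
  have "x $ j * f x = (\<Sum>b\<in>?B (Suc k). (if b \<in> s ` ?B k then v (r b) else 0) * monomial b x)" for x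
  proof -
    have "x $ j * f x = (\<Sum>b\<in>?B k. v (r (s b)) * monomial (s b) x)"
      unfolding v sum_distrib_left rs unfolding s_def monomial_fun_upd by (simp add: ac_simps)
    also have "\<dots> = (\<Sum>b\<in>s ` ?B k. v (r b) * monomial b x)"
      by (simp add: sum.reindex[OF inj])
    also have "\<dots> = (\<Sum>b\<in>?B (Suc k). (if b \<in> s ` ?B k then v (r b) else 0) * monomial b x)"
      by (intro sum.mono_neutral_cong_left) (use fin in \<open>auto simp: s_def PiE_iff Pi_iff le_SucI\<close>)
    finally show ?thesis .
  qed
  then show ?case by (intro exI[of _ "\<lambda>b. if b \<in> s ` ?B k then v (r b) else 0"] allI)
qed

text \<open>The digits below the largest position \<open>n\<close> contribute less than
  \<open>M ^ n\<close>, so division by \<open>M ^ n\<close> reads off the digit at \<open>n\<close>.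
  This keeps the exponents in Kronecker's substitution distinct.\<close>

lemma digits_inject:
  fixes A :: "nat set" and M :: nat
  assumes "finite A" "\<And>i. i \<in> A \<Longrightarrow> a i < M" "\<And>i. i \<in> A \<Longrightarrow> b i < M"
    and "(\<Sum>i\<in>A. a i * M ^ i) = (\<Sum>i\<in>A. b i * M ^ i)"
  shows "\<forall>i\<in>A. a i = b i"
  using assms
proof (induction A rule: finite_linorder_max_induct)
  case empty
  then show ?case by simp
next
  case (insert n A)
  have n: "n \<notin> A" using insert.hyps by auto
  have less: "(\<Sum>i\<in>A. c i * M ^ i) < M ^ n" if c: "\<And>i. i \<in> A \<Longrightarrow> c i < M" for c
  proof -
    have "(\<Sum>i\<in>A. c i * M ^ i) \<le> (\<Sum>i\<in>A. (M - 1) * M ^ i)"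
      by (intro sum_mono mult_right_mono) (use c in fastforce)+
    also have "\<dots> \<le> (\<Sum>i<n. (M - 1) * M ^ i)"
      by (intro sum_mono2) (use insert.hyps in auto)
    finally have le: "(\<Sum>i\<in>A. c i * M ^ i) \<le> (\<Sum>i<n. (M - 1) * M ^ i)" .
    obtain M' where M': "M = Suc M'" using insert.prems(1)[of n] by (cases M) auto
    have "Suc (\<Sum>i<k. M' * M ^ i) = M ^ k" for k
      by (induction k) (simp_all add: M')
    from this[of n] show ?thesis using le by (simp add: M')
  qed
  define x where "x = (\<Sum>i\<in>A. a i * M ^ i)"
  define y where "y = (\<Sum>i\<in>A. b i * M ^ i)"
  have eq: "a n * M ^ n + x = b n * M ^ n + y"
    using insert.prems(3) n insert.hyps by (simp add: x_def y_def)
  have xy: "x < M ^ n" "y < M ^ n" unfolding x_def y_def by (intro less insert.prems; simp)+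
  have "(a n * M ^ n + x) div M ^ n = a n" "(b n * M ^ n + y) div M ^ n = b n"
    using xy div_mult_self3[of "M ^ n"] by (metis add_0_right div_less less_nat_zero_code)+
  then have "a n = b n" unfolding eq by simp
  moreover have "x = y" using eq calculation by simp
  then have "\<forall>i\<in>A. a i = b i"
    unfolding x_def y_def by (intro insert.IH insert.prems) auto
  ultimately show ?case by simp
qed

lemma finite_power_sum_zeros:
  fixes c :: "'a \<Rightarrow> real" and e :: "'a \<Rightarrow> nat"
  assumes "finite X" "inj_on e X" "a \<in> X" "c a \<noteq> 0"
  shows "finite {u. (\<Sum>x\<in>X. c x * u ^ e x) = 0}"
proof -
  define p where "p = (\<Sum>x\<in>X. Polynomial.monom (c x) (e x))"
  have "coeff p (e a) = (\<Sum>x\<in>X. if x = a then c x else 0)"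
    unfolding p_def coeff_sum
    by (intro sum.cong) (use assms in \<open>auto simp: inj_on_def\<close>)
  then have "p \<noteq> 0" using assms by auto
  moreover have "poly p u = (\<Sum>x\<in>X. c x * u ^ e x)" for u
    by (simp add: p_def poly_sum poly_monom)
  ultimately show ?thesis using poly_roots_finite[of p] by simp
qed

text \<open>More than \<open>m\<close> polynomials in \<open>m\<close> variables satisfy a nontrivial polynomial relation, and
  Kronecker's substitution turns it into a nonzero univariate polynomial in \<open>u\<close>.\<close>

lemma finite_common_level:
  fixes g :: "nat \<Rightarrow> real^'m::finite \<Rightarrow> real"
  assumes A: "card A = CARD('m) + 1" and g: "\<And>i. i \<in> A \<Longrightarrow> poly_deg_le k (g i)"
    and M: "((CARD('m) + 1) * k + 1) ^ CARD('m) < M"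
  shows "finite {u. \<exists>x. \<forall>i\<in>A. g i x = u ^ (M ^ i)}"
proof -
  have finA: "finite A" using A by (metis card.infinite add_is_0 one_neq_zero)
  define K where "K = (CARD('m) + 1) * (M * k)"
  define X where "X = PiE A (\<lambda>_. {..<M})"
  define B where "B = PiE (UNIV :: 'm set) (\<lambda>_. {..K})"
  define F where "F = (\<lambda>a x. \<Prod>i\<in>A. g i x ^ a i)"
  have fin: "finite X" "finite B" unfolding X_def B_def using finA by (auto intro: finite_PiE)
  have M1: "M \<ge> 1" using M by simp
  have F: "poly_deg_le K (F a)" if "a \<in> X" for a
  proof (rule poly_deg_le_mono)
    show "poly_deg_le (\<Sum>i\<in>A. a i * k) (F a)"
      unfolding F_def by (intro poly_deg_le_prod poly_deg_le_power g)
    have "(\<Sum>i\<in>A. a i * k) \<le> (\<Sum>i\<in>A. M * k)"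
      using that by (intro sum_mono mult_right_mono) (auto simp: X_def PiE_def Pi_def less_imp_le)
    then show "(\<Sum>i\<in>A. a i * k) \<le> K" by (simp add: A K_def)
  qed
  have "\<exists>v. \<forall>a\<in>X. \<forall>x. F a x = (\<Sum>b\<in>B. v a b * monomial b x)"
    using bchoice[of X "\<lambda>a v. \<forall>x. F a x = (\<Sum>b\<in>B. v b * monomial b x)"]
      poly_deg_le_expansion[OF F] unfolding B_def by blast
  then obtain v where v: "\<And>a x. a \<in> X \<Longrightarrow> F a x = (\<Sum>b\<in>B. v a b * monomial b x)" by blast
  \<comment> \<open>The number \<open>M ^ (CARD('m) + 1)\<close> of products \<open>F a\<close> has
    one factor \<open>M\<close> more than the bound for the number of monomials; the hypothesis on
    \<open>M\<close> lets it absorb the remaining constant.\<close>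
  have "card B = (K + 1) ^ CARD('m)" by (simp add: B_def card_PiE)
  also have "\<dots> \<le> (M * ((CARD('m) + 1) * k + 1)) ^ CARD('m)"
    by (intro power_mono) (use M1 in \<open>auto simp: K_def algebra_simps\<close>)
  also have "\<dots> = M ^ CARD('m) * ((CARD('m) + 1) * k + 1) ^ CARD('m)"
    by (rule power_mult_distrib)
  also have "\<dots> < M ^ CARD('m) * M" using M M1 by simp
  also have "\<dots> = card X" using finA by (simp add: X_def card_PiE A)
  finally have less: "card B < card X" .
  from underdetermined_system[OF fin(2,1) less, of v]
  obtain c where "(\<exists>a\<in>X. c a \<noteq> 0) \<and> (\<forall>b\<in>B. (\<Sum>a\<in>X. c a * v a b) = 0)" ..
  note c = this[THEN conjunct1] this[THEN conjunct2, rule_format]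
  have dep: "(\<Sum>a\<in>X. c a * F a x) = 0" for x
  proof -
    have "(\<Sum>a\<in>X. c a * F a x) = (\<Sum>a\<in>X. \<Sum>b\<in>B. c a * v a b * monomial b x)"
      by (intro sum.cong) (auto simp: v sum_distrib_left mult.assoc)
    also have "\<dots> = (\<Sum>b\<in>B. (\<Sum>a\<in>X. c a * v a b) * monomial b x)"
      by (subst sum.swap) (simp add: sum_distrib_right)
    finally show ?thesis using c(2) by simp
  qed
  \<comment> \<open>On a common level \<open>g i x = u ^ (M ^ i)\<close> the product
    \<open>F a x\<close> equals \<open>u ^ e a\<close>.\<close>
  define e where "e = (\<lambda>a. \<Sum>i\<in>A. a i * M ^ i)"
  have inj: "inj_on e X"
  proof (rule inj_onI)
    fix a b assume ab: "a \<in> X" "b \<in> X" "e a = e b"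
    then have "\<forall>i\<in>A. a i = b i"
      by (intro digits_inject[OF finA, of a M b]) (auto simp: e_def X_def PiE_def Pi_def)
    then show "a = b" using ab by (auto simp: X_def intro: PiE_ext)
  qed
  have "{u. \<exists>x. \<forall>i\<in>A. g i x = u ^ (M ^ i)} \<subseteq> {u. (\<Sum>a\<in>X. c a * u ^ e a) = 0}"
  proof safe
    fix u :: real and x assume x: "\<forall>i\<in>A. g i x = u ^ (M ^ i)"
    have "F a x = u ^ e a" for a
      unfolding F_def e_def power_sum
      by (intro prod.cong refl) (use x in \<open>simp flip: power_mult add: mult.commute\<close>)
    then show "(\<Sum>a\<in>X. c a * u ^ e a) = 0" using dep[of x] by simp
  qed
  moreover obtain a where "a \<in> X" "c a \<noteq> 0" using c(1) by auto
  ultimately show ?thesis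
    using finite_power_sum_zeros[OF fin(1) inj, of a c] by (meson finite_subset)
qed

text \<open>The cell is replaced by a face \<open>A\<close> on which as many constraints as possible are tight.
  By maximality no further constraint is tight on that face, so it is separated from the rest
  of the boundary, and the penalised minimum stays close to it.\<close>

lemma penalised_minimum_in_cell:
  fixes s :: "nat \<Rightarrow> real^'m::finite \<Rightarrow> real"
  assumes I: "finite I" and cont: "\<And>i. i \<in> I \<Longrightarrow> continuous_on UNIV (s i)"
    and pos: "\<And>i. i \<in> I \<Longrightarrow> 0 < \<epsilon> i"
    and generic: "\<And>A x. A \<subseteq> I \<Longrightarrow> card A = r + 1 \<Longrightarrow> \<forall>i\<in>A. s i x = \<epsilon> i \<Longrightarrow> False"
    and nonempty: "\<forall>i\<in>I. \<epsilon> i \<le> s i p"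
    and e: "e > 0"
  shows "\<exists>A \<eta>0. A \<subseteq> I \<and> card A \<le> r \<and> 0 < \<eta>0 \<and> (\<forall>\<eta>. 0 < \<eta> \<and> \<eta> \<le> \<eta>0 \<longrightarrow>
    (\<exists>y U. open U \<and> y \<in> U \<and> (\<forall>i\<in>I. 0 < s i y) \<and>
      (\<forall>z\<in>U. (\<Sum>i\<in>A. (s i y - \<epsilon> i)\<^sup>2) + \<eta> * (\<Sum>j\<in>UNIV. (y $ j) ^ (2 * e))
         \<le> (\<Sum>i\<in>A. (s i z - \<epsilon> i)\<^sup>2) + \<eta> * (\<Sum>j\<in>UNIV. (z $ j) ^ (2 * e)))))"
proof -
  define C where "C = {x. \<forall>i\<in>I. \<epsilon> i \<le> s i x}"
  define tight where "tight = (\<lambda>x. {i\<in>I. s i x = \<epsilon> i})"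
  have tight_le: "card (tight x) \<le> r" for x
  proof (rule ccontr)
    assume "\<not> ?thesis"
    then have "r + 1 \<le> card (tight x)" by simp
    then obtain A where "A \<subseteq> tight x" "card A = r + 1"
      using obtain_subset_with_card_n by metis
    then show False by (intro generic[of A x]) (auto simp: tight_def)
  qed
  have "p \<in> C" using nonempty by (simp add: C_def)
  then obtain x0 where x0: "x0 \<in> C" "\<And>x. x \<in> C \<Longrightarrow> card (tight x) \<le> card (tight x0)"
    using ex_has_greatest_nat[of "\<lambda>x. x \<in> C" p "\<lambda>x. card (tight x)" "r + 1"] tight_le
    by (metis le_imp_less_Suc Suc_eq_plus1)
  define A where "A = tight x0"
  have A: "A \<subseteq> I" "finite A" using I by (auto simp: A_def tight_def)
  have maximal: "tight y = A" if "y \<in> C" "\<forall>i\<in>A. s i y = \<epsilon> i" for y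
  proof -
    have "A \<subseteq> tight y" using that A by (auto simp: tight_def)
    moreover have "finite (tight y)" using I by (simp add: tight_def)
    ultimately show ?thesis using x0(2)[OF that(1)] A_def by (metis card_seteq)
  qed
  define G where "G = (\<lambda>z. \<Sum>i\<in>A. (s i z - \<epsilon> i)\<^sup>2)"
  define \<Psi> where "\<Psi> = (\<lambda>z::real^'m. \<Sum>j\<in>UNIV. (z $ j) ^ (2 * e))"
  have contG: "continuous_on S G" and cont\<Psi>: "continuous_on S \<Psi>" for S
    unfolding G_def \<Psi>_def using A
    by (auto intro!: continuous_intros intro: continuous_on_subset[OF cont])
  have \<Psi>0: "\<Psi> z \<ge> 0" and G0: "G z \<ge> 0" for z
    by (auto simp: \<Psi>_def G_def intro!: sum_nonneg)
  \<comment> \<open>Constraints tight at \<open>x0\<close> are relaxed to half their threshold, so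
    that the face stays off their boundary; the others keep theirs. All bounds remain positive, so
    points of \<open>U\<close> have the right signs.\<close>
  define lower where "lower = (\<lambda>i. if i \<in> A then \<epsilon> i / 2 else \<epsilon> i)"
  define D where "D = (\<Inter>i\<in>I. {x. lower i \<le> s i x})"
  define U where "U = (\<Inter>i\<in>I. {x. lower i < s i x})"
  have lower: "lower i > 0" "lower i \<le> \<epsilon> i" if "i \<in> I" for i
    using pos[OF that] by (auto simp: lower_def)
  have openU: "open U" unfolding U_def
    using I by (intro open_INT ballI open_Collect_less) (auto intro: cont)
  have closedD: "closed D" unfolding D_def
    by (intro closed_INT ballI closed_Collect_le) (auto intro: cont)
  \<comment> \<open>Outside this sublevel set the penalised value exceeds the one at
    \<open>x0\<close>, where \<open>G\<close> vanishes; hence minimising over the compact set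
    \<open>K\<close> is enough.\<close>
  define K where "K = {z. \<Psi> z \<le> \<Psi> x0} \<inter> D"
  have "bounded {z. \<Psi> z \<le> \<Psi> x0}"
  proof -
    have "\<bar>z $ j\<bar> \<le> 1 + \<Psi> x0" if z: "\<Psi> z \<le> \<Psi> x0" for z j
    proof (rule ccontr)
      assume *: "\<not> ?thesis"
      have "\<bar>z $ j\<bar> ^ 1 \<le> \<bar>z $ j\<bar> ^ (2 * e)"
        using * \<Psi>0[of x0] e by (intro power_increasing) auto
      also have "\<dots> = (z $ j) ^ (2 * e)" by (simp add: power_even_abs)
      also have "\<dots> \<le> \<Psi> z" unfolding \<Psi>_def by (rule member_le_sum) auto
      finally show False using * z by simp
    qed
    then have "norm z \<le> (\<Sum>j\<in>(UNIV::'m set). 1 + \<Psi> x0)" if "\<Psi> z \<le> \<Psi> x0" for z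
      by (intro order_trans[OF norm_le_l1_cart] sum_mono) (use that in auto)
    then show ?thesis by (auto simp: bounded_iff)
  qed
  moreover have "closed {z. \<Psi> z \<le> \<Psi> x0}" by (intro closed_Collect_le cont\<Psi>) auto
  ultimately have compactK: "compact K"
    unfolding K_def using closedD by (intro compact_Int_closed) (simp_all add: compact_eq_bounded_closed)
  have x0K: "x0 \<in> K" using x0(1) lower by (force simp: K_def D_def C_def)
  have Gx0: "G x0 = 0" by (auto simp: G_def A_def tight_def)
  \<comment> \<open>A zero of \<open>G\<close> in \<open>K\<close> lies in \<open>C\<close> and on
    the face. By maximality its tight set is exactly \<open>A\<close>, so the other inequalities are
    strict and the point is in \<open>U\<close>.\<close>
  have Gpos: "G z > 0" if "z \<in> K - U" for z
  proof (rule ccontr)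
    assume "\<not> ?thesis"
    then have "G z = 0" using G0[of z] by simp
    then have zA: "\<forall>i\<in>A. s i z = \<epsilon> i" using A by (simp add: G_def sum_nonneg_eq_0_iff)
    have "z \<in> C" unfolding C_def
    proof safe
      fix i assume "i \<in> I"
      then show "\<epsilon> i \<le> s i z"
        using that zA by (cases "i \<in> A") (auto simp: K_def D_def lower_def)
    qed
    then have t: "tight z = A" using maximal zA by blast
    have "z \<in> U" unfolding U_def
    proof safe
      fix i assume i: "i \<in> I"
      show "lower i < s i z"
      proof (cases "i \<in> A")
        case True
        then show ?thesis using zA pos[OF i] by (simp add: lower_def)
      next
        case False
        then have "s i z \<noteq> \<epsilon> i" using t i by (auto simp: tight_def)
        then show ?thesis using False \<open>z \<in> C\<close> i by (simp add: lower_def C_def order_less_le)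
      qed
    qed
    then show False using that by simp
  qed
  obtain \<mu> where \<mu>: "\<mu> > 0" "\<And>z. z \<in> K - U \<Longrightarrow> \<mu> \<le> G z"
  proof (cases "K - U = {}")
    case True
    then show ?thesis using that[of 1] by auto
  next
    case False
    have "compact (K - U)" using compactK openU by (rule compact_diff)
    then obtain w where "w \<in> K - U" "\<forall>z\<in>K - U. G w \<le> G z"
      using continuous_attains_inf[OF _ False contG] by blast
    then show ?thesis using that[of "G w"] Gpos by auto
  qed
  \<comment> \<open>Chosen so that \<open>\<eta> * \<Psi> x0\<close> stays below the lower bound
    \<open>\<mu>\<close> of \<open>G\<close> on \<open>K - U\<close>, which forces the minimiser
    into \<open>U\<close>. Adding 1 guards against \<open>\<Psi> x0 = 0\<close>.\<close>
  define \<eta>0 where "\<eta>0 = \<mu> / (\<Psi> x0 + 1)"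
  have \<eta>0: "\<eta>0 > 0" "\<eta>0 * \<Psi> x0 < \<mu>"
    using \<mu> \<Psi>0[of x0] by (auto simp: \<eta>0_def field_simps)
  have "\<exists>y U. open U \<and> y \<in> U \<and> (\<forall>i\<in>I. 0 < s i y) \<and> (\<forall>z\<in>U. G y + \<eta> * \<Psi> y \<le> G z + \<eta> * \<Psi> z)"
    if \<eta>: "0 < \<eta>" "\<eta> \<le> \<eta>0" for \<eta>
  proof -
    have "continuous_on K (\<lambda>z. G z + \<eta> * \<Psi> z)" by (intro continuous_intros contG cont\<Psi>)
    then obtain y where y: "y \<in> K" "\<And>z. z \<in> K \<Longrightarrow> G y + \<eta> * \<Psi> y \<le> G z + \<eta> * \<Psi> z"
      using continuous_attains_inf[OF compactK] x0K by blast
    have yx0: "G y + \<eta> * \<Psi> y \<le> \<eta> * \<Psi> x0" using y(2)[OF x0K] Gx0 by simp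
    have "y \<in> U"
    proof (rule ccontr)
      assume "y \<notin> U"
      then have "\<mu> \<le> G y" using y \<mu> by simp
      moreover have "\<eta> * \<Psi> x0 \<le> \<eta>0 * \<Psi> x0" using \<eta> \<Psi>0 by (intro mult_right_mono) auto
      moreover have "0 \<le> \<eta> * \<Psi> y" using \<eta> \<Psi>0 by simp
      ultimately show False using yx0 \<eta>0 by linarith
    qed
    moreover have "G y + \<eta> * \<Psi> y \<le> G z + \<eta> * \<Psi> z" if "z \<in> U" for z
    proof (cases "z \<in> K")
      case False
      have "z \<in> D" using that by (force simp: U_def D_def)
      then have "\<Psi> x0 < \<Psi> z" using False by (simp add: K_def)
      then have "\<eta> * \<Psi> x0 \<le> \<eta> * \<Psi> z" using \<eta> by simp
      then show ?thesis using yx0 G0[of z] by linarith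
    qed (rule y)
    moreover have "0 < s i y" if "i \<in> I" for i
      using \<open>y \<in> U\<close> that lower(1)[OF that] by (force simp: U_def)
    ultimately show ?thesis using openU by blast
  qed
  then show ?thesis
    using A(1) tight_le[of x0] \<eta>0(1) unfolding A_def[symmetric] G_def \<Psi>_def by blast
qed

text \<open>At a local minimum the gradient vanishes. The penalty contributes a multiple of
  \<open>(y $ j) ^ (k + 1)\<close> to partial derivative \<open>j\<close> and \<open>G\<close> only
  degree at most \<open>k\<close>; solving for the power gives the system of
  \<open>card_solutions_le\<close>.\<close>

lemma card_local_minima_le:
  fixes X :: "(real^'m::finite) set"
  assumes "finite X" and G: "poly_deg_le k G" and \<eta>: "\<eta> > 0"
    and min: "\<And>y. y \<in> X \<Longrightarrow> \<exists>U. open U \<and> y \<in> U \<and>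
      (\<forall>z\<in>U. G y + \<eta> * (\<Sum>j\<in>UNIV. (y $ j) ^ (k + 2)) \<le> G z + \<eta> * (\<Sum>j\<in>UNIV. (z $ j) ^ (k + 2)))"
  shows "card X \<le> (k + 1) ^ CARD('m)"
proof -
  obtain D where D: "\<And>x. (G has_derivative (\<lambda>h. \<Sum>i\<in>UNIV. D i x * h $ i)) (at x)"
    "\<And>i. poly_deg_le k (D i)" using poly_deg_le_deriv[OF G] by blast
  let ?g = "\<lambda>j x. (- 1 / (\<eta> * (k + 2))) * D j x"
  show ?thesis
  proof (rule card_solutions_le[of X k ?g])
    show "poly_deg_le k (?g j)" for j by (intro poly_deg_le_cmult D)
    fix y j assume y: "y \<in> X"
    let ?F = "\<lambda>z. G z + \<eta> * (\<Sum>j\<in>UNIV. (z $ j) ^ (k + 2))"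
    let ?F' = "\<lambda>h. (\<Sum>i\<in>UNIV. D i y * h $ i)
        + \<eta> * (\<Sum>i\<in>UNIV. of_nat (k + 2) * h $ i * (y $ i) ^ (k + 2 - 1))"
    have "(?F has_derivative ?F') (at y)"
      by (intro has_derivative_add D has_derivative_mult_right has_derivative_sum
          has_derivative_power bounded_linear_imp_has_derivative bounded_linear_vec_nth)
    moreover obtain U where "open U" "y \<in> U" "\<forall>z\<in>U. ?F y \<le> ?F z" using min[OF y] by blast
    ultimately have "?F' = (\<lambda>v. 0)"
      using differential_zero_maxmin[of y U ?F ?F'] by blast
    then have "?F' (axis j 1) = 0" by meson
    then have "D j y + \<eta> * (real (k + 2) * (y $ j) ^ (k + 1)) = 0"
      by (simp add: axis_def if_distrib[of "\<lambda>t. _ * t"] if_distrib[of "\<lambda>t. t * _"] cong: if_cong)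
    then have "(\<eta> * real (k + 2)) * (y $ j) ^ (k + 1) = - D j y"
      by (simp only: mult.assoc)
    then have "(y $ j) ^ (k + 1) = - D j y / (\<eta> * real (k + 2))"
      using \<eta> by (metis eq_divide_eq mult.commute mult_pos_pos of_nat_0_less_iff
          add_gr_0 zero_less_numeral order_less_irrefl)
    then show "(y $ j) ^ (k + 1) = ?g j y" by simp
  qed fact
qed

section \<open>Assembling the count over faces, signs and minima\<close>

lemma card_signed_faces:
  fixes I :: "'a set"
  assumes I: "finite I"
  shows "card (Sigma {A. A \<subseteq> I \<and> card A \<le> m} Pow) = (\<Sum>k\<le>m. (card I choose k) * 2 ^ k)"
proof -
  have fin: "finite {A. A \<subseteq> I \<and> card A = k}" for k using I by simp
  have *: "{A. A \<subseteq> I \<and> card A \<le> m} = (\<Union>k\<in>{..m}. {A. A \<subseteq> I \<and> card A = k})" by auto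
  have "card (Sigma {A. A \<subseteq> I \<and> card A \<le> m} Pow) = (\<Sum>A | A \<subseteq> I \<and> card A \<le> m. card (Pow A))"
    using I by (intro card_SigmaI) (auto intro: finite_subset)
  also have "\<dots> = (\<Sum>k\<le>m. \<Sum>A | A \<subseteq> I \<and> card A = k. card (Pow A))"
    unfolding * using fin by (intro sum.UNION_disjoint) auto
  also have "\<dots> = (\<Sum>k\<le>m. \<Sum>A | A \<subseteq> I \<and> card A = k. 2 ^ k)"
    by (intro sum.cong refl) (use I in \<open>auto simp: card_Pow dest: finite_subset\<close>)
  also have "\<dots> = (\<Sum>k\<le>m. (card I choose k) * 2 ^ k)"
    using I by (simp add: n_subsets)
  finally show ?thesis .
qed

lemma card_le_mult_fibres:
  assumes "finite P" "finite K" "\<And>x. x \<in> P \<Longrightarrow> key x \<in> K"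
    and "\<And>k. k \<in> K \<Longrightarrow> card {x\<in>P. key x = k} \<le> b"
  shows "card P \<le> b * card K"
proof -
  have "P = (\<Union>k\<in>K. {x\<in>P. key x = k})" using assms(3) by auto
  then have "card P \<le> (\<Sum>k\<in>K. card {x\<in>P. key x = k})"
    using card_UN_le[OF assms(2)] by metis
  also have "\<dots> \<le> (\<Sum>k\<in>K. b)" by (intro sum_mono assms)
  finally show ?thesis by (simp add: mult.commute)
qed

text \<open>The squared thresholds run along the curve \<open>u ^ (M ^ i)\<close>, and each set of
  \<open>CARD('m) + 1\<close> indices rules out finitely many \<open>u\<close>. Squaring doubles the
  degree but removes signs, so one choice serves all cells.\<close>

lemma generic_thresholds:
  fixes f :: "nat \<Rightarrow> real^'m::finite \<Rightarrow> real"
  assumes I: "finite I" and f: "\<And>i. i \<in> I \<Longrightarrow> poly_deg_le \<delta> (f i)" and b: "b > 0"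
  shows "\<exists>\<epsilon>. (\<forall>i\<in>I. 0 < \<epsilon> i \<and> \<epsilon> i \<le> b) \<and>
    (\<forall>A x. A \<subseteq> I \<and> card A = CARD('m) + 1 \<longrightarrow> \<not> (\<forall>i\<in>A. \<bar>f i x\<bar> = \<epsilon> i))"
proof -
  define M where "M = ((CARD('m) + 1) * (2 * \<delta>) + 1) ^ CARD('m) + 1"
  define bad where "bad = (\<lambda>A. {u. \<exists>x. \<forall>i\<in>A. (f i x)\<^sup>2 = u ^ (M ^ i)})"
  let ?\<A> = "{A. A \<subseteq> I \<and> card A = CARD('m) + 1}"
  have "finite (bad A)" if "A \<in> ?\<A>" for A
    unfolding bad_def
    by (rule finite_common_level[where k = "2 * \<delta>"])
      (use that in \<open>auto simp: M_def intro!: poly_deg_le_power f\<close>)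
  moreover have "finite ?\<A>" using I by simp
  ultimately have "finite (\<Union>(bad ` ?\<A>))" by blast
  \<comment> \<open>With \<open>sqrt u\<close> below both 1 and \<open>b\<close>, all its positive
    powers stay below \<open>b\<close>.\<close>
  moreover define t0 where "t0 = min 1 b"
  have t0: "t0 > 0" using b by (simp add: t0_def)
  then have "infinite {0<..<t0\<^sup>2}" by simp
  ultimately have "infinite ({0<..<t0\<^sup>2} - \<Union>(bad ` ?\<A>))" by (intro Diff_infinite_finite)
  then have "{0<..<t0\<^sup>2} - \<Union>(bad ` ?\<A>) \<noteq> {}" by (rule infinite_imp_nonempty)
  then obtain u where "u \<in> {0<..<t0\<^sup>2} - \<Union>(bad ` ?\<A>)" unfolding ex_in_conv[symmetric] ..
  then have u: "0 < u" "u < t0\<^sup>2" "u \<notin> \<Union>(bad ` ?\<A>)" by simp_all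
  define \<epsilon> where "\<epsilon> = (\<lambda>i. sqrt u ^ (M ^ i))"
  have s: "0 < sqrt u" "sqrt u < t0" using u t0 by (auto intro: real_less_lsqrt)
  have "\<epsilon> i \<le> b" for i
  proof -
    have "\<epsilon> i \<le> sqrt u ^ 1" unfolding \<epsilon>_def
      using s by (intro power_decreasing) (auto simp: t0_def M_def)
    then show ?thesis using s by (simp add: t0_def)
  qed
  moreover have "0 < \<epsilon> i" for i using s by (simp add: \<epsilon>_def)
  moreover have False if A: "A \<in> ?\<A>" and x: "\<forall>i\<in>A. \<bar>f i x\<bar> = \<epsilon> i" for A x
  proof -
    have "(f i x)\<^sup>2 = u ^ (M ^ i)" if "i \<in> A" for i
    proof -
      have "(f i x)\<^sup>2 = (\<epsilon> i)\<^sup>2" using x that by (metis power2_abs)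
      also have "\<dots> = ((sqrt u)\<^sup>2) ^ (M ^ i)" by (simp only: \<epsilon>_def flip: power_mult) (simp add: mult.commute)
      finally show ?thesis using u by simp
    qed
    then have "u \<in> bad A" by (auto simp: bad_def)
    then show False using u A by blast
  qed
  ultimately show ?thesis by (intro exI[of _ \<epsilon>]) blast
qed

text \<open>Each pattern gets a face and a local minimum in its cell. The signs at that minimum
  determine the pattern, so patterns sharing the face and the signs on it inject into the minima of
  one function.\<close>

lemma card_sign_patterns_le:
  fixes f :: "nat \<Rightarrow> real^'m::finite \<Rightarrow> real"
  assumes I: "finite I" and f: "\<And>i. i \<in> I \<Longrightarrow> poly_deg_le \<delta> (f i)"
    and P: "P \<subseteq> Pow I"
    and realised: "\<And>T. T \<in> P \<Longrightarrow> \<exists>x. (\<forall>i\<in>T. 0 < f i x) \<and> (\<forall>i\<in>I - T. f i x < 0)"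
  shows "card P \<le> (2 * \<delta> + 1) ^ CARD('m) * (\<Sum>k\<le>CARD('m). (card I choose k) * 2 ^ k)"
proof -
  have finP: "finite P" using P I by (meson finite_Pow_iff finite_subset)
  define \<sigma> where "\<sigma> = (\<lambda>(T::nat set) i. if i \<in> T then 1 else - 1 :: real)"
  have "\<exists>w. \<forall>T\<in>P. \<forall>i\<in>I. 0 < \<sigma> T i * f i (w T)"
  proof (intro bchoice ballI)
    fix T assume T: "T \<in> P"
    from realised[OF T] obtain x where "\<forall>i\<in>T. 0 < f i x" "\<forall>i\<in>I - T. f i x < 0" by blast
    then show "\<exists>x. \<forall>i\<in>I. 0 < \<sigma> T i * f i x"
      by (intro exI[of _ x]) (auto simp: \<sigma>_def)
  qed
  then obtain w where w: "\<And>T i. T \<in> P \<Longrightarrow> i \<in> I \<Longrightarrow> 0 < \<sigma> T i * f i (w T)" by blast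
  \<comment> \<open>A common lower bound for the values at the witnesses keeps every shrunken cell
    nonempty; the inserted 1 covers an empty set of values.\<close>
  define b where "b = Min (insert 1 ((\<lambda>(T, i). \<sigma> T i * f i (w T)) ` (P \<times> I)))"
  have b: "b > 0" unfolding b_def using finP I w by (subst Min_gr_iff) auto
  have b_le: "b \<le> \<sigma> T i * f i (w T)" if "T \<in> P" "i \<in> I" for T i
    unfolding b_def using finP I that by (intro Min_le) auto
  obtain \<epsilon> where \<epsilon>: "\<And>i. i \<in> I \<Longrightarrow> 0 < \<epsilon> i" "\<And>i. i \<in> I \<Longrightarrow> \<epsilon> i \<le> b"
    "\<And>A x. A \<subseteq> I \<Longrightarrow> card A = CARD('m) + 1 \<Longrightarrow> \<not> (\<forall>i\<in>A. \<bar>f i x\<bar> = \<epsilon> i)"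
    using generic_thresholds[of I \<delta> f b, OF I f b] by blast
  define G where "G = (\<lambda>A T z. \<Sum>i\<in>A. (\<sigma> T i * f i z - \<epsilon> i)\<^sup>2)"
  define \<Psi> where "\<Psi> = (\<lambda>z::real^'m. \<Sum>j\<in>UNIV. (z $ j) ^ (2 * \<delta> + 2))"
  define locmin where "locmin = (\<lambda>\<eta> A T y. \<exists>U. open U \<and> y \<in> U \<and>
    (\<forall>z\<in>U. G A T y + \<eta> * \<Psi> y \<le> G A T z + \<eta> * \<Psi> z))"
  have ex: "\<exists>A \<eta>0. A \<subseteq> I \<and> card A \<le> CARD('m) \<and> 0 < \<eta>0 \<and>
     (\<forall>\<eta>. 0 < \<eta> \<and> \<eta> \<le> \<eta>0 \<longrightarrow> (\<exists>y. locmin \<eta> A T y \<and> (\<forall>i\<in>I. 0 < \<sigma> T i * f i y)))"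
    if T: "T \<in> P" for T
  proof -
    have cont: "continuous_on UNIV (\<lambda>x. \<sigma> T i * f i x)" if "i \<in> I" for i
      by (intro continuous_intros continuous_on_poly_deg_le[OF f[OF that]])
    have generic: False if A: "A \<subseteq> I" "card A = CARD('m) + 1" and x: "\<forall>i\<in>A. \<sigma> T i * f i x = \<epsilon> i" for A x
    proof -
      have "\<bar>f i x\<bar> = \<epsilon> i" if "i \<in> A" for i
      proof -
        have "0 < \<epsilon> i" "\<sigma> T i * f i x = \<epsilon> i" using that A x \<epsilon> by auto
        then show ?thesis by (auto simp: \<sigma>_def split: if_splits)
      qed
      then show False using \<epsilon>(3)[OF A, of x] by blast
    qed
    have base: "\<forall>i\<in>I. \<epsilon> i \<le> \<sigma> T i * f i (w T)" using \<epsilon>(2) b_le[OF T] by force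
    have e: "2 * \<delta> + 2 = 2 * (\<delta> + 1)" by simp
    have "\<exists>A \<eta>0. A \<subseteq> I \<and> card A \<le> CARD('m) \<and> 0 < \<eta>0 \<and> (\<forall>\<eta>. 0 < \<eta> \<and> \<eta> \<le> \<eta>0 \<longrightarrow>
      (\<exists>y U. open U \<and> y \<in> U \<and> (\<forall>i\<in>I. 0 < \<sigma> T i * f i y) \<and>
        (\<forall>z\<in>U. G A T y + \<eta> * \<Psi> y \<le> G A T z + \<eta> * \<Psi> z)))"
      using penalised_minimum_in_cell[of I "\<lambda>i x. \<sigma> T i * f i x" \<epsilon> "CARD('m)" "w T" "\<delta> + 1",
          OF I cont \<epsilon>(1) generic base]
      by (simp only: G_def \<Psi>_def e zero_less_Suc add_gr_0 zero_less_one simp_thms)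
    then obtain A \<eta>0 where A: "A \<subseteq> I" "card A \<le> CARD('m)" "0 < \<eta>0"
      and min: "\<forall>\<eta>. 0 < \<eta> \<and> \<eta> \<le> \<eta>0 \<longrightarrow>
        (\<exists>y U. open U \<and> y \<in> U \<and> (\<forall>i\<in>I. 0 < \<sigma> T i * f i y) \<and>
          (\<forall>z\<in>U. G A T y + \<eta> * \<Psi> y \<le> G A T z + \<eta> * \<Psi> z))"
      by (elim exE conjE)
    have "\<exists>y. locmin \<eta> A T y \<and> (\<forall>i\<in>I. 0 < \<sigma> T i * f i y)" if \<eta>: "0 < \<eta> \<and> \<eta> \<le> \<eta>0" for \<eta>
    proof -
      obtain y U where "open U" "y \<in> U" "\<forall>i\<in>I. 0 < \<sigma> T i * f i y"
        "\<forall>z\<in>U. G A T y + \<eta> * \<Psi> y \<le> G A T z + \<eta> * \<Psi> z"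
        using min[rule_format, OF \<eta>] by (elim exE conjE)
      then show ?thesis unfolding locmin_def by (intro exI[of _ y] exI[of _ U] conjI)
    qed
    then show ?thesis
      by (intro exI[of _ A] exI[of _ \<eta>0] conjI allI impI A)
  qed
  have "\<forall>T\<in>P. \<exists>p. fst p \<subseteq> I \<and> card (fst p) \<le> CARD('m) \<and> 0 < snd p \<and>
     (\<forall>\<eta>. 0 < \<eta> \<and> \<eta> \<le> snd p \<longrightarrow> (\<exists>y. locmin \<eta> (fst p) T y \<and> (\<forall>i\<in>I. 0 < \<sigma> T i * f i y)))"
    (is "\<forall>T\<in>P. \<exists>p. ?R T p")
  proof
    fix T assume "T \<in> P"
    from ex[OF this] obtain A \<eta>0 where "?R T (A, \<eta>0)" unfolding fst_conv snd_conv by blast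
    then show "\<exists>p. ?R T p" by (rule exI)
  qed
  from bchoice[OF this] obtain p where p: "\<And>T. T \<in> P \<Longrightarrow> fst (p T) \<subseteq> I"
    "\<And>T. T \<in> P \<Longrightarrow> card (fst (p T)) \<le> CARD('m)" "\<And>T. T \<in> P \<Longrightarrow> 0 < snd (p T)"
    "\<And>T \<eta>. T \<in> P \<Longrightarrow> 0 < \<eta> \<Longrightarrow> \<eta> \<le> snd (p T) \<Longrightarrow>
       \<exists>y. locmin \<eta> (fst (p T)) T y \<and> (\<forall>i\<in>I. 0 < \<sigma> T i * f i y)"
    by blast
  \<comment> \<open>A single \<open>\<eta>\<close> for all patterns lets the minima within a fibre
    belong to the same function.\<close>
  define \<eta> where "\<eta> = Min (insert 1 ((\<lambda>T. snd (p T)) ` P))"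
  have \<eta>: "\<eta> > 0" unfolding \<eta>_def using finP p(3) by (subst Min_gr_iff) auto
  have \<eta>_le: "\<eta> \<le> snd (p T)" if "T \<in> P" for T
    unfolding \<eta>_def using finP that by (intro Min_le) auto
  have "\<forall>T\<in>P. \<exists>y. locmin \<eta> (fst (p T)) T y \<and> (\<forall>i\<in>I. 0 < \<sigma> T i * f i y)"
    using p(4) \<eta> \<eta>_le by blast
  from bchoice[OF this] obtain y where y: "\<And>T. T \<in> P \<Longrightarrow> locmin \<eta> (fst (p T)) T (y T)"
    "\<And>T i. T \<in> P \<Longrightarrow> i \<in> I \<Longrightarrow> 0 < \<sigma> T i * f i (y T)"
    by blast
  have recover: "T = {i\<in>I. 0 < f i (y T)}" if "T \<in> P" for T
  proof (rule set_eqI)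
    fix i
    show "i \<in> T \<longleftrightarrow> i \<in> {i\<in>I. 0 < f i (y T)}"
      using y(2)[OF that, of i] subsetD[OF P that] by (auto simp: \<sigma>_def split: if_splits)
  qed
  \<comment> \<open>\<open>G A T\<close> depends on \<open>T\<close> only through
    \<open>T \<inter> A\<close>, so \<open>key\<close> determines the function whose minima are
    counted.\<close>
  define key where "key = (\<lambda>T. (fst (p T), T \<inter> fst (p T)))"
  have "card P \<le> (2 * \<delta> + 1) ^ CARD('m) * card (Sigma {A. A \<subseteq> I \<and> card A \<le> CARD('m)} Pow)"
  proof (rule card_le_mult_fibres[where key = key])
    show "finite (Sigma {A. A \<subseteq> I \<and> card A \<le> CARD('m)} Pow)"
      by (intro finite_SigmaI) (use I in \<open>auto intro: finite_subset\<close>)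
    show "key T \<in> Sigma {A. A \<subseteq> I \<and> card A \<le> CARD('m)} Pow" if "T \<in> P" for T
      using p(1,2)[OF that] by (auto simp: key_def)
  next
    fix \<kappa> assume \<kappa>: "\<kappa> \<in> Sigma {A. A \<subseteq> I \<and> card A \<le> CARD('m)} Pow"
    obtain A B where AB: "\<kappa> = (A, B)" by fastforce
    let ?F = "{T\<in>P. key T = \<kappa>}"
    have "inj_on y ?F"
      by (rule inj_on_inverseI[where g = "\<lambda>v. {i\<in>I. 0 < f i v}"]) (simp add: recover[symmetric])
    then have "card ?F = card (y ` ?F)" by (simp add: card_image)
    also have "\<dots> \<le> (2 * \<delta> + 1) ^ CARD('m)"
    proof (rule card_local_minima_le[OF _ _ \<eta>])
      show "finite (y ` ?F)" using finP by simp
      have "poly_deg_le (2 * \<delta>) (\<lambda>z. (\<sigma> B i * f i z - \<epsilon> i)\<^sup>2)" if "i \<in> A" for i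
        using that \<kappa> AB by (intro poly_deg_le_power poly_deg_le_diff_const poly_deg_le_cmult f) auto
      then show "poly_deg_le (2 * \<delta>) (G A B)" unfolding G_def by (rule poly_deg_le_sum)
      fix v assume "v \<in> y ` ?F"
      then obtain T where T: "T \<in> P" "v = y T" "A = fst (p T)" "B = T \<inter> A"
        by (auto simp: key_def AB)
      have "G A T = G A B"
        unfolding G_def T(4) by (intro ext sum.cong) (auto simp: \<sigma>_def)
      then show "\<exists>U. open U \<and> v \<in> U \<and> (\<forall>z\<in>U. G A B v + \<eta> * (\<Sum>j\<in>UNIV. v $ j ^ (2 * \<delta> + 2))
           \<le> G A B z + \<eta> * (\<Sum>j\<in>UNIV. z $ j ^ (2 * \<delta> + 2)))"
        using y(1)[OF T(1)] T unfolding locmin_def \<Psi>_def by simp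
    qed
    finally show "card ?F \<le> (2 * \<delta> + 1) ^ CARD('m)" .
  qed (fact finP)
  then show ?thesis by (simp add: card_signed_faces[OF I])
qed

section \<open>Sylvester's criterion\<close>

definition pos_def :: "real^'n^'n \<Rightarrow> bool" where
  "pos_def A \<longleftrightarrow> (\<forall>v. v \<noteq> 0 \<longrightarrow> 0 < v \<bullet> (A *v v))"

text \<open>Padding with identity rows and columns keeps blocks of all sizes in one matrix type; the
  determinant is the principal minor of \<open>A\<close> on \<open>S\<close>.\<close>

definition principal_block :: "'n set \<Rightarrow> real^'n^'n \<Rightarrow> real^'n^'n" where
  "principal_block S A = (\<chi> i j. if i \<in> S \<and> j \<in> S then A $ i $ j else if i = j then 1 else 0)"

lemma principal_block_delete:
  "principal_block (- {i}) (principal_block S A) = principal_block (S - {i}) A"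
  by (simp add: principal_block_def vec_eq_iff)

lemma det_nonzero_if_pos_def:
  fixes A :: "real^'n::finite^'n"
  assumes "pos_def A" shows "det A \<noteq> 0"
proof
  assume "det A = 0"
  then have "\<not> (\<exists>B. B ** A = mat 1)"
    by (metis det_mul det_I mult_zero_right zero_neq_one)
  then obtain v where "v \<noteq> 0" "A *v v = 0" by (auto simp: matrix_left_invertible_ker)
  then show False using assms by (force simp: pos_def_def)
qed

text \<open>The segment from the identity to \<open>A\<close> consists of positive definite
  matrices, so the determinant starts at 1 and never vanishes along it.\<close>

lemma det_pos_if_pos_def:
  fixes A :: "real^'n::finite^'n"
  assumes A: "pos_def A" shows "0 < det A"
proof (rule ccontr)
  assume neg: "\<not> 0 < det A"
  define B where "B = (\<lambda>s::real. s *\<^sub>R A + (1 - s) *\<^sub>R (mat 1 :: real^'n^'n))"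
  have "continuous_on {0..1} (\<lambda>s. det (B s))"
    unfolding det_def B_def by (simp, intro continuous_intros)
  moreover have "det (B 0) = 1" "det (B 1) = det A" by (simp_all add: B_def)
  ultimately obtain s where s: "0 \<le> s" "s \<le> 1" "det (B s) = 0"
    using IVT2'[of "\<lambda>s. det (B s)" 1 0 0] neg by auto
  have "pos_def (B s)" unfolding pos_def_def
  proof safe
    fix v :: "real^'n" assume v: "v \<noteq> 0"
    have *: "v \<bullet> (B s *v v) = s * (v \<bullet> (A *v v)) + (1 - s) * (v \<bullet> v)"
      by (simp add: B_def matrix_vector_mult_add_rdistrib inner_add_right
          scaleR_matrix_vector_assoc[symmetric])
    have "0 < v \<bullet> (A *v v)" "0 < v \<bullet> v" using A v by (auto simp: pos_def_def)
    then show "0 < v \<bullet> (B s *v v)" unfolding * using s(1,2)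
      by (cases "s = 0") (auto intro!: add_pos_nonneg)
  qed
  then show False using det_nonzero_if_pos_def s by blast
qed

lemma inner_matrix_vector:
  fixes A :: "real^'n::finite^'n"
  shows "v \<bullet> (A *v w) = (\<Sum>i\<in>UNIV. \<Sum>j\<in>UNIV. v $ i * A $ i $ j * w $ j)"
  by (simp add: inner_vec_def matrix_vector_mult_def sum_distrib_left mult.assoc)

text \<open>The form at \<open>v\<close> splits into the form of \<open>A\<close> at the restriction
  \<open>u\<close> of \<open>v\<close> to \<open>S\<close> and the squares of the entries off
  \<open>S\<close>.\<close>

lemma pos_def_principal_block:
  fixes A :: "real^'n::finite^'n"
  assumes A: "pos_def A" shows "pos_def (principal_block S A)"
  unfolding pos_def_def
proof safe
  fix v :: "real^'n" assume v: "v \<noteq> 0"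
  define u where "u = (\<chi> i. if i \<in> S then v $ i else 0)"
  have "v \<bullet> (principal_block S A *v v) = (\<Sum>i\<in>UNIV. (\<Sum>j\<in>UNIV. u $ i * A $ i $ j * u $ j)
      + (\<Sum>j\<in>UNIV. if i = j then (if i \<in> S then 0 else (v $ i)\<^sup>2) else 0))"
    unfolding inner_matrix_vector sum.distrib[symmetric]
    by (intro sum.cong) (auto simp: u_def principal_block_def power2_eq_square)
  also have "\<dots> = u \<bullet> (A *v u) + (\<Sum>i\<in>UNIV. if i \<in> S then 0 else (v $ i)\<^sup>2)"
    by (simp add: inner_matrix_vector sum.distrib)
  finally have eq: "v \<bullet> (principal_block S A *v v) = \<dots>" .
  have nn: "0 \<le> (\<Sum>i\<in>UNIV. if i \<in> S then 0 else (v $ i)\<^sup>2)" by (intro sum_nonneg) auto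
  show "0 < v \<bullet> (principal_block S A *v v)"
  proof (cases "u = 0")
    case False
    then have "0 < u \<bullet> (A *v u)" using A by (simp add: pos_def_def)
    then show ?thesis unfolding eq using nn by simp
  next
    case True
    obtain i where i: "v $ i \<noteq> 0" using v by (auto simp: vec_eq_iff)
    have "u $ i = 0" using True by simp
    then have "i \<notin> S" using i by (auto simp: u_def)
    then have "0 < (\<Sum>i\<in>UNIV. if i \<in> S then 0 else (v $ i)\<^sup>2)"
      using i by (intro sum_pos2[of _ i]) auto
    then show ?thesis unfolding eq using True by simp
  qed
qed

text \<open>Bordering step of Sylvester's criterion: by Cramer's rule the solution of \<open>B w = e\<^sub>i\<close> has
  a positive \<open>i\<close>-th entry, and subtracting a multiple of \<open>w\<close> reduces to vectors whose \<open>i\<close>-th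
  entry vanishes.\<close>

lemma pos_def_border:
  fixes B :: "real^'n::finite^'n"
  assumes sym: "sym_mat B" and det: "0 < det B"
    and C: "pos_def (principal_block (- {i}) B)"
  shows "pos_def B"
proof -
  let ?C = "principal_block (- {i}) B"
  define w where "w = (\<chi> k. det (\<chi> p q. if q = k then axis i 1 $ p else B $ p $ q) / det B)"
  have Bw: "B *v w = axis i 1"
    unfolding cramer[OF less_imp_neq[OF det, symmetric]] w_def by simp
  \<comment> \<open>Compared permutation by permutation: if \<open>\<pi> i = i\<close>, row
    \<open>i\<close> enters only through its diagonal entry 1 and all factors agree; otherwise both
    products contain a zero from column \<open>i\<close>.\<close>
  have "det (\<chi> p q. if q = i then axis i 1 $ p else B $ p $ q) = det ?C"
    unfolding det_def
  proof (intro sum.cong refl arg_cong2[where f = "(*)"])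
    fix \<pi> assume "\<pi> \<in> {p. p permutes (UNIV :: 'n set)}"
    then have \<pi>: "\<pi> permutes UNIV" by simp
    show "(\<Prod>p\<in>UNIV. (\<chi> p q. if q = i then axis i 1 $ p else B $ p $ q) $ p $ \<pi> p)
        = (\<Prod>p\<in>UNIV. ?C $ p $ \<pi> p)"
    proof (cases "\<pi> i = i")
      case True
      then have eq: "\<pi> p = i \<longleftrightarrow> p = i" for p using \<pi> by (metis permutes_inverses(2))
      show ?thesis
      proof (intro prod.cong refl)
        fix p
        show "(\<chi> p q. if q = i then axis i 1 $ p else B $ p $ q) $ p $ \<pi> p = ?C $ p $ \<pi> p"
          using eq[of p] True by (cases "p = i") (simp_all add: principal_block_def axis_def)
      qed
    next
      case False
      obtain p where p: "\<pi> p = i" using \<pi> by (metis permutes_inverses(1))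
      then have "p \<noteq> i" using False by auto
      then show ?thesis
        by (subst (1 2) prod_zero) (use p in \<open>auto simp: principal_block_def axis_def intro!: exI[of _ p]\<close>)
    qed
  qed
  then have "w $ i = det ?C / det B" by (simp add: w_def)
  then have wi: "w $ i > 0" using det_pos_if_pos_def[OF C] det by simp
  have symB: "x \<bullet> (B *v y) = (B *v x) \<bullet> y" for x y
    using sym by (metis sym_mat_def dot_lmul_matrix vector_transpose_matrix)
  show ?thesis unfolding pos_def_def
  proof safe
    fix v :: "real^'n" assume v: "v \<noteq> 0"
    \<comment> \<open>\<open>a\<close> is chosen to clear entry \<open>i\<close> of
      \<open>u\<close>. As \<open>B *v w\<close> is the unit vector at \<open>i\<close>, the cross
      terms between \<open>u\<close> and \<open>w\<close> vanish.\<close>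
    define a where "a = v $ i / w $ i"
    define u where "u = v - a *\<^sub>R w"
    have ui: "u $ i = 0" using wi by (simp add: u_def a_def)
    have uBw: "u \<bullet> (B *v w) = 0" "w \<bullet> (B *v u) = 0" "w \<bullet> (B *v w) = w $ i"
      using ui by (simp_all add: symB[of w u] Bw inner_axis inner_axis')
    have "v = u + a *\<^sub>R w" by (simp add: u_def)
    then have "v \<bullet> (B *v v) = u \<bullet> (B *v u) + a\<^sup>2 * w $ i"
      using uBw by (simp add: matrix_vector_right_distrib matrix_vector_mult_scaleR inner_add_left
          inner_add_right power2_eq_square)
    also have "u \<bullet> (B *v u) = u \<bullet> (?C *v u)"
      unfolding inner_matrix_vector using ui
      by (intro sum.cong refl) (auto simp: principal_block_def)
    finally have eq: "v \<bullet> (B *v v) = u \<bullet> (?C *v u) + a\<^sup>2 * w $ i" .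
    show "0 < v \<bullet> (B *v v)"
    proof (cases "u = 0")
      case True
      then have "a \<noteq> 0" using v by (auto simp: u_def)
      then show ?thesis unfolding eq using True wi by simp
    next
      case False
      then have "0 < u \<bullet> (?C *v u)" using C by (simp add: pos_def_def)
      then show ?thesis unfolding eq using wi by (intro add_pos_nonneg) auto
    qed
  qed
qed

text \<open>\<open>idx\<close> fixes an arbitrary order in which leading minors are taken. For the
  converse the blocks grow by one index at a time, from the identity at the empty set, through
  \<open>pos_def_border\<close>.\<close>

lemma sylvester_criterion:
  fixes A :: "real^'n::finite^'n"
  assumes sym: "sym_mat A" and idx: "bij_betw idx (UNIV :: 'n set) {..<CARD('n)}"
  shows "pos_def A \<longleftrightarrow> (\<forall>i. 0 < det (principal_block {j. idx j \<le> idx i} A))"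
proof
  assume "pos_def A"
  then show "\<forall>i. 0 < det (principal_block {j. idx j \<le> idx i} A)"
    by (intro allI det_pos_if_pos_def pos_def_principal_block)
next
  assume minors: "\<forall>i. 0 < det (principal_block {j. idx j \<le> idx i} A)"
  have "k \<le> CARD('n) \<Longrightarrow> pos_def (principal_block {j. idx j < k} A)" for k
  proof (induction k)
    case 0
    have "principal_block {} A = mat 1" by (simp add: principal_block_def mat_def vec_eq_iff)
    then show ?case by (simp add: pos_def_def)
  next
    case (Suc k)
    then obtain i where i: "idx i = k"
      using idx by (metis Suc_le_eq bij_betw_iff_bijections lessThan_iff)
    let ?B = "principal_block {j. idx j < Suc k} A"
    have eq: "idx j = k \<longleftrightarrow> j = i" for j
      using idx i by (metis UNIV_I bij_betw_iff_bijections)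
    have "{j. idx j < Suc k} - {i} = {j. idx j < k}"
    proof (rule set_eqI)
      fix j
      show "j \<in> {j. idx j < Suc k} - {i} \<longleftrightarrow> j \<in> {j. idx j < k}"
        using eq[of j] i by (cases "j = i") auto
    qed
    then have "principal_block (- {i}) ?B = principal_block {j. idx j < k} A"
      by (simp only: principal_block_delete)
    then have "pos_def (principal_block (- {i}) ?B)" using Suc by simp
    moreover have "sym_mat ?B"
      using sym by (auto simp: sym_mat_def principal_block_def transpose_def vec_eq_iff)
    moreover have "0 < det ?B" using minors[rule_format, of i] i by (simp add: less_Suc_eq_le)
    ultimately show ?case using pos_def_border[of ?B i] by blast
  qed
  from this[of "CARD('n)"] have "pos_def (principal_block {j. idx j < CARD('n)} A)" by simp
  moreover have "idx j < CARD('n)" for j using idx by (auto simp: bij_betw_def)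
  moreover have "principal_block UNIV A = A" by (simp add: principal_block_def vec_eq_iff)
  ultimately show "pos_def A" by simp
qed

section \<open>Degrees of determinants and passage to strict definiteness\<close>

lemma poly_deg_le_det:
  fixes A :: "real^'m::finite \<Rightarrow> real^'n::finite^'n"
  assumes "\<And>i j. poly_deg_le k (\<lambda>x. A x $ i $ j)"
  shows "poly_deg_le (CARD('n) * k) (\<lambda>x. det (A x))"
  unfolding det_def
proof (intro poly_deg_le_sum poly_deg_le_cmult)
  fix p
  have "poly_deg_le (\<Sum>i\<in>(UNIV::'n set). k) (\<lambda>x. \<Prod>i\<in>UNIV. A x $ i $ p i)"
    by (intro poly_deg_le_prod assms)
  then show "poly_deg_le (CARD('n) * k) (\<lambda>x. \<Prod>i\<in>UNIV. A x $ i $ p i)" by simp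
qed

lemma pos_def_shift:
  fixes A :: "real^'n::finite^'n"
  assumes "psd A" "b > 0" shows "pos_def (A + b *\<^sub>R mat 1)"
  using assms
  by (auto simp: psd_def pos_def_def matrix_vector_mult_add_rdistrib inner_add_right
      scaleR_matrix_vector_assoc[symmetric] intro!: add_nonneg_pos)

text \<open>A vector with a negative value of the form refutes definiteness as long as the shift is
  at most minus that value divided by its squared length.\<close>

lemma not_pos_def_shift:
  fixes A :: "real^'n::finite^'n"
  assumes "\<not> psd A" shows "\<exists>b0>0. \<forall>b\<le>b0. \<not> pos_def (A + b *\<^sub>R mat 1)"
proof -
  obtain v where v: "v \<bullet> (A *v v) < 0" using assms by (auto simp: psd_def not_le)
  then have v0: "v \<noteq> 0" by auto
  then have vv: "v \<bullet> v > 0" by simp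
  have "\<not> pos_def (A + b *\<^sub>R mat 1)" if b: "b \<le> - (v \<bullet> (A *v v)) / (v \<bullet> v)" for b
  proof -
    have "b * (v \<bullet> v) \<le> - (v \<bullet> (A *v v))" using mult_right_mono[OF b, of "v \<bullet> v"] vv by simp
    then have "v \<bullet> ((A + b *\<^sub>R mat 1) *v v) \<le> 0"
      by (simp add: matrix_vector_mult_add_rdistrib inner_add_right scaleR_matrix_vector_assoc[symmetric])
    then show ?thesis using v0 by (auto simp: pos_def_def not_less)
  qed
  moreover have "- (v \<bullet> (A *v v)) / (v \<bullet> v) > 0" using v vv by (intro divide_pos_pos) auto
  ultimately show ?thesis by blast
qed

section \<open>The numerical estimate\<close>

text \<open>For the weight \<open>q = m / N\<close>, at most 1, \<open>q ^ m \<le> q ^ k\<close>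
  holds whenever \<open>k \<le> m\<close>; the full weighted sum is \<open>(q + 1) ^ N\<close>,
  which is at most \<open>exp 1 ^ m\<close>.\<close>

lemma sum_binomial_le:
  assumes "1 \<le> m" "m \<le> N"
  shows "real (\<Sum>k\<le>m. N choose k) \<le> (exp 1 * real N / real m) ^ m"
proof -
  define q where "q = real m / real N"
  have q: "0 < q" "q \<le> 1" using assms by (auto simp: q_def)
  have "(\<Sum>k\<le>m. real (N choose k)) * q ^ m = (\<Sum>k\<le>m. real (N choose k) * q ^ m)"
    by (simp add: sum_distrib_right)
  also have "\<dots> \<le> (\<Sum>k\<le>m. real (N choose k) * q ^ k)"
    by (intro sum_mono mult_left_mono power_decreasing) (use q in auto)
  also have "\<dots> \<le> (\<Sum>k\<le>N. real (N choose k) * q ^ k)"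
    by (intro sum_mono2) (use assms q in auto)
  also have "\<dots> = (q + 1) ^ N" by (subst binomial_ring) simp
  also have "\<dots> \<le> exp q ^ N" using exp_ge_add_one_self[of q] q by (intro power_mono) (auto simp: add.commute)
  also have "\<dots> = exp 1 ^ m" using assms by (simp add: exp_of_nat_mult[symmetric] q_def)
  finally have "(\<Sum>k\<le>m. real (N choose k)) \<le> exp 1 ^ m / q ^ m"
    using q by (simp add: pos_le_divide_eq)
  also have "\<dots> = (exp 1 * real N / real m) ^ m" by (simp add: q_def power_divide power_mult_distrib)
  finally show ?thesis by simp
qed

text \<open>The summands are 2 for the factor 4, at most 3/2 for \<open>exp 1\<close> since its
  square is below 8, at most \<open>n - 1\<close> for \<open>n\<close> since
  \<open>n \<le> 2 ^ (n - 1)\<close>, and \<open>n\<close>.\<close>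

lemma log2_bound: "log 2 (4 * exp 1 * real n * 2 ^ n) \<le> 2 * real n + 5 / 2" if n: "n \<ge> 1"
proof -
  have "exp (1::real) ^ 2 \<le> 8"
  proof -
    have "exp (1::real) ^ 2 \<le> 2.72 ^ 2" using e_less_272 by (intro power_mono) auto
    also have "\<dots> \<le> 8" by (simp add: power2_eq_square)
    finally show ?thesis .
  qed
  then have "log 2 (exp (1::real) ^ 2) \<le> log 2 8" by simp
  also have "log 2 8 = (3::real)" using log_pow_cancel[of 2 3] by simp
  finally have e: "2 * log 2 (exp 1) \<le> (3::real)" by (simp add: log_nat_power)
  have "real n \<le> 2 ^ (n - 1)"
  proof -
    obtain k where k: "n = Suc k" using n by (cases n) auto
    have "Suc k \<le> 2 ^ k" by (induction k) auto
    then have "real (Suc k) \<le> real (2 ^ k)" by (subst of_nat_le_iff)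
    then show ?thesis by (simp add: k)
  qed
  then have "log 2 (real n) \<le> log 2 (2 ^ (n - 1))"
    using n by (intro log_le_cancel_iff[THEN iffD2]) auto
  also have "log 2 (2 ^ (n - 1)) = real n - 1" using n by (simp add: log_nat_power of_nat_diff)
  finally have "log 2 (real n) \<le> real n - 1" .
  moreover have "log 2 4 = (2::real)" using log_pow_cancel[of 2 2] by simp
  ultimately show ?thesis using e n by (simp add: log_mult log_nat_power)
qed

text \<open>With \<open>t = 2 * L + r\<close> the right side is
  \<open>(4 * exp 1 * n * 2 ^ n) ^ 2 * 2 powr r\<close>. On the left, the square absorbs the part
  from \<open>2 * L\<close>, and \<open>2 powr r - 1\<close> outgrows the part linear in
  \<open>r\<close>.\<close>

lemma exponential_beats_linear:
  fixes t :: real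
  assumes n: "n \<ge> 1" and t: "2 * log 2 (4 * exp 1 * real n * 2 ^ n) < t"
  shows "(8 * real n + 2) * exp 1 * real n * t < 2 powr t"
proof -
  define L where "L = log 2 (4 * exp 1 * real n * 2 ^ n)"
  define r where "r = t - 2 * L"
  \<comment> \<open>\<open>n * E\<close> is that square divided by the factor
    \<open>exp 1 * n\<close> of the left side.\<close>
  define E where "E = 16 * exp 1 * (4::real) ^ n"
  have r: "r > 0" using t by (simp add: r_def L_def)
  have E: "E \<ge> 32 * (1 + 3 * real n)"
  proof -
    have "1 + real n * 3 \<le> (1 + 3) ^ n" by (rule Bernoulli_inequality) simp
    moreover have "2 \<le> exp (1::real)" using exp_ge_add_one_self[of 1] by simp
    ultimately have "16 * 2 * (1 + real n * 3) \<le> 16 * exp 1 * 4 ^ n"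
      by (intro mult_mono) auto
    then show ?thesis by (simp add: E_def algebra_simps)
  qed
  have L: "0 \<le> L" "L \<le> 2 * real n + 5 / 2"
  proof -
    have "1 * 1 * 1 \<le> exp 1 * real n * 2 ^ n" using n by (intro mult_mono) auto
    then show "0 \<le> L" by (simp add: L_def mult.assoc)
    show "L \<le> 2 * real n + 5 / 2" using log2_bound[OF n] by (simp add: L_def)
  qed
  have n1: "real n \<ge> 1" using n by simp
  have "(8 * real n + 2) * t = (8 * real n + 2) * (2 * L) + (8 * real n + 2) * r"
    by (simp add: r_def algebra_simps)
  also have "(8 * real n + 2) * (2 * L) \<le> (10 * real n) * (4 * real n + 5)"
    using n1 L by (intro mult_mono) auto
  finally have lhs: "(8 * real n + 2) * t \<le> (10 * real n) * (4 * real n + 5) + (8 * real n + 2) * r"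
    by simp
  have "(10 * real n) * (4 * real n + 5) = real n * (40 * real n + 50)" by (simp add: algebra_simps)
  also have "\<dots> \<le> real n * E" using E n1 by (intro mult_left_mono) auto
  finally have 1: "(10 * real n) * (4 * real n + 5) \<le> real n * E" .
  have half: "r / 2 < 2 powr r - 1"
  proof -
    have "1/2 < ln (2::real)" using ln2_ge_two_thirds by simp
    then have "r / 2 < r * ln 2" using r by simp
    also have "\<dots> \<le> exp (r * ln 2) - 1" using exp_ge_add_one_self[of "r * ln 2"] by linarith
    finally show ?thesis by (simp add: powr_def)
  qed
  have "(8 * real n + 2) * r \<le> real n * E * (r / 2)"
  proof -
    have "2 * (8 * real n + 2) \<le> 1 * E" using E n1 by simp
    also have "\<dots> \<le> real n * E" using n1 E by (intro mult_right_mono) auto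
    finally have "2 * (8 * real n + 2) * (r / 2) \<le> real n * E * (r / 2)" using r by (intro mult_right_mono) auto
    then show ?thesis by (simp add: algebra_simps)
  qed
  also have "\<dots> < real n * E * (2 powr r - 1)" using half E n1 by (intro mult_strict_left_mono) auto
  finally have "(8 * real n + 2) * t < real n * E * 2 powr r"
    using lhs 1 by (simp add: algebra_simps)
  then have "(8 * real n + 2) * t * (exp 1 * real n) < real n * E * 2 powr r * (exp 1 * real n)"
    using n1 by (intro mult_strict_right_mono) auto
  also have "\<dots> = (4 * exp 1 * real n * 2 ^ n) ^ 2 * 2 powr r"
    by (simp add: E_def power2_eq_square power_mult_distrib[symmetric] algebra_simps
        flip: power_mult_distrib)
  also have "(4 * exp 1 * real n * 2 ^ n) ^ 2 = (2 powr L) ^ 2"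
    using n by (simp add: L_def)
  also have "(2 powr L) ^ 2 * 2 powr r = 2 powr t"
    by (simp add: power2_eq_square r_def flip: powr_add)
  finally show ?thesis by (simp add: algebra_simps)
qed

text \<open>With \<open>t = d / m\<close>, the \<open>m\<close>-th root of the count bounds
  \<open>2 powr t\<close> by \<open>(8 * n + 2) * exp 1 * n * t\<close>, which
  \<open>exponential_beats_linear\<close> excludes for large \<open>t\<close>.\<close>

lemma pattern_count_imp_bound:
  assumes n: "n \<ge> 1" and m: "m \<ge> 1"
    and count: "2 ^ d \<le> (4 * n + 1) ^ m * (\<Sum>k\<le>m. (n * d choose k) * (2::nat) ^ k)"
  shows "real d \<le> 2 * real m * log 2 (4 * exp 1 * real n * 2 ^ n)"
proof (rule ccontr)
  assume neg: "\<not> ?thesis"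
  define t where "t = real d / real m"
  let ?L = "log 2 (4 * exp 1 * real n * 2 ^ n)"
  have t: "2 * ?L < t" using neg m by (simp add: t_def field_simps)
  \<comment> \<open>As \<open>?L\<close> is at least 2, \<open>t\<close> exceeds 1; this gives
    \<open>m \<le> n * d\<close>, as the binomial estimate requires.\<close>
  have "2 = log 2 (4::real)" using log_pow_cancel[of 2 2] by simp
  also have "\<dots> \<le> ?L"
  proof -
    have "4 * 1 * 1 * 1 \<le> 4 * exp 1 * real n * 2 ^ n" using n by (intro mult_mono) auto
    then show ?thesis using n by (intro log_le_cancel_iff[THEN iffD2]) auto
  qed
  finally have "t \<ge> 1" using t by simp
  then have "m \<le> d" using m by (simp add: t_def)
  then have mN: "m \<le> n * d" using n le_trans[of m d "n * d"] by simp
  note count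
  also have "(4 * n + 1) ^ m * (\<Sum>k\<le>m. (n * d choose k) * (2::nat) ^ k)
      \<le> (4 * n + 1) ^ m * (\<Sum>k\<le>m. (n * d choose k) * 2 ^ m)"
    by (intro mult_left_mono sum_mono power_increasing) auto
  also have "\<dots> = (4 * n + 1) ^ m * ((\<Sum>k\<le>m. n * d choose k) * 2 ^ m)"
    by (simp only: sum_distrib_right)
  finally have "2 ^ d \<le> (4 * n + 1) ^ m * ((\<Sum>k\<le>m. n * d choose k) * (2::nat) ^ m)" .
  then have "real (2 ^ d) \<le> real ((4 * n + 1) ^ m * ((\<Sum>k\<le>m. (n * d choose k)) * (2::nat) ^ m))"
    by (subst of_nat_le_iff)
  also have "\<dots> = real (4 * n + 1) ^ m * (real (\<Sum>k\<le>m. (n * d choose k)) * 2 ^ m)" by simp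
  also have "\<dots> \<le> real (4 * n + 1) ^ m * ((exp 1 * real (n * d) / real m) ^ m * 2 ^ m)"
    by (intro mult_left_mono mult_right_mono sum_binomial_le m mN) auto
  also have "\<dots> = (real (4 * n + 1) * (exp 1 * real (n * d) / real m * 2)) ^ m"
    by (simp only: power_mult_distrib)
  also have "real (4 * n + 1) * (exp 1 * real (n * d) / real m * 2) = (8 * real n + 2) * exp 1 * real n * t"
    by (simp add: t_def algebra_simps add_divide_distrib)
  also have "\<dots> ^ m < (2 powr t) ^ m"
    using exponential_beats_linear[OF n t] m \<open>t \<ge> 1\<close> by (intro power_strict_mono) auto
  also have "\<dots> = 2 powr (real d)"
    using m by (simp add: t_def powr_realpow[symmetric] powr_powr)
  finally show False by (simp add: powr_realpow)
qed

section \<open>The VC-dimension bound\<close>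

text \<open>Entries of degree 2 cover the affine and the bilinear family. Each point contributes
  \<open>CARD('n)\<close> leading minors, and distinct subsets of \<open>S\<close> give distinct
  sign patterns.\<close>

lemma card_psd_shattered_le:
  fixes F :: "real^'m::finite \<Rightarrow> 'q \<Rightarrow> real^'n::finite^'n"
  assumes S: "finite S"
    and sym: "\<And>\<theta> q. q \<in> S \<Longrightarrow> sym_mat (F \<theta> q)"
    and deg: "\<And>q i j. q \<in> S \<Longrightarrow> poly_deg_le 2 (\<lambda>\<theta>. F \<theta> q $ i $ j)"
    and shatter: "\<And>T. T \<subseteq> S \<Longrightarrow> \<exists>\<theta>. {q\<in>S. \<not> psd (F \<theta> q)} = T"
  shows "real (card S) \<le> 2 * real CARD('m) * log 2 (4 * exp 1 * real CARD('n) * 2 ^ CARD('n))"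
proof -
  have "\<forall>T\<in>Pow S. \<exists>\<theta>. {q\<in>S. \<not> psd (F \<theta> q)} = T" using shatter by simp
  from bchoice[OF this] obtain \<theta> where \<theta>: "\<And>T. T \<subseteq> S \<Longrightarrow> {q\<in>S. \<not> psd (F (\<theta> T) q)} = T"
    by auto
  have "\<forall>p\<in>Sigma (Pow S) (\<lambda>T. T). \<exists>b0>0. \<forall>b\<le>b0. \<not> pos_def (F (\<theta> (fst p)) (snd p) + b *\<^sub>R mat 1)"
  proof (intro ballI not_pos_def_shift)
    fix p assume "p \<in> Sigma (Pow S) (\<lambda>T. T)"
    then have "fst p \<subseteq> S" "snd p \<in> fst p" by auto
    then show "\<not> psd (F (\<theta> (fst p)) (snd p))" using \<theta>[of "fst p"] by blast
  qed
  from bchoice[OF this] obtain b0 where b0': "\<forall>p\<in>Sigma (Pow S) (\<lambda>T. T). 0 < b0 p \<and>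
      (\<forall>b\<le>b0 p. \<not> pos_def (F (\<theta> (fst p)) (snd p) + b *\<^sub>R mat 1))" ..
  have b0: "0 < b0 (T, q)" "b \<le> b0 (T, q) \<Longrightarrow> \<not> pos_def (F (\<theta> T) q + b *\<^sub>R mat 1)"
    if "T \<subseteq> S" "q \<in> T" for T q b
    using b0'[rule_format, of "(T, q)"] that by simp_all
  \<comment> \<open>Finitely many failures of semidefiniteness occur at the chosen parameters, so
    one small shift preserves them all while making the semidefinite matrices positive
    definite.\<close>
  define b where "b = Min (insert 1 (b0 ` Sigma (Pow S) (\<lambda>T. T)))"
  have fin: "finite (Sigma (Pow S) (\<lambda>T. T))"
    by (intro finite_SigmaI) (use S in \<open>auto intro: finite_subset\<close>)
  have b: "b > 0" unfolding b_def using fin b0(1) by (subst Min_gr_iff) auto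
  have b_le: "b \<le> b0 (T, q)" if "T \<subseteq> S" "q \<in> T" for T q
    unfolding b_def using fin that by (intro Min_le) auto
  define A where "A = (\<lambda>q \<theta>. F \<theta> q + b *\<^sub>R (mat 1 :: real^'n^'n))"
  have pd: "pos_def (A q (\<theta> T)) \<longleftrightarrow> q \<notin> T" if "T \<subseteq> S" "q \<in> S" for T q
  proof (cases "q \<in> T")
    case True
    then show ?thesis using b0(2)[OF that(1) True b_le] that by (simp add: A_def)
  next
    case False
    then have "psd (F (\<theta> T) q)" using \<theta>[OF that(1)] that by auto
    then show ?thesis using False b by (simp add: A_def pos_def_shift)
  qed
  obtain idx where idx: "bij_betw idx (UNIV :: 'n set) {..<CARD('n)}"
    using ex_bij_betw_finite_nat[of "UNIV :: 'n set"] by (auto simp: atLeast0LessThan)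
  define g where "g = (\<lambda>(q, i) \<theta>. det (principal_block {j. idx j \<le> idx i} (A q \<theta>)))"
  have pd_minors: "q \<notin> T \<longleftrightarrow> (\<forall>i. 0 < g (q, i) (\<theta> T))" if "T \<subseteq> S" "q \<in> S" for T q
  proof -
    have "sym_mat (A q (\<theta> T))"
      using sym[OF that(2)] by (auto simp: A_def sym_mat_def transpose_def vec_eq_iff mat_def)
    from sylvester_criterion[OF this idx] show ?thesis
      using pd[OF that] by (simp add: g_def)
  qed
  have g_deg: "poly_deg_le (CARD('n) * 2) (g p)" if p: "p \<in> S \<times> UNIV" for p
  proof -
    obtain q i where [simp]: "p = (q, i)" by fastforce
    have A_deg: "poly_deg_le 2 (\<lambda>\<theta>. A q \<theta> $ r $ s)" for r s
      using poly_deg_le.add[OF deg poly_deg_le.const, of q r s "(b *\<^sub>R (mat 1 :: real^'n^'n)) $ r $ s"] p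
      by (simp add: A_def)
    have "poly_deg_le 2 (\<lambda>\<theta>. principal_block U (A q \<theta>) $ r $ s)" for U r s
      by (cases "r \<in> U \<and> s \<in> U"; cases "r = s")
        (auto simp: principal_block_def intro: A_deg poly_deg_le.const)
    then show ?thesis unfolding g_def by (simp add: poly_deg_le_det)
  qed
  let ?V = "{v \<in> (\<lambda>(T, p). g p (\<theta> T)) ` (Pow S \<times> (S \<times> UNIV)). 0 < v}"
  \<comment> \<open>Subtracting half the least positive value keeps positive minors positive and
    makes zero minors negative, as strict sign patterns are needed.\<close>
  define c where "c = Min (insert 1 ?V) / 2"
  have finV: "finite ?V" using S by simp
  have "Min (insert 1 ?V) > 0" using finV by (subst Min_gr_iff) auto
  then have c: "c > 0" by (simp add: c_def)
  have c_less: "c < g p (\<theta> T)" if "T \<subseteq> S" "p \<in> S \<times> UNIV" "0 < g p (\<theta> T)" for T p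
  proof -
    have "g p (\<theta> T) \<in> ?V" using that by force
    then have "Min (insert 1 ?V) \<le> g p (\<theta> T)" using finV by (intro Min_le) auto
    then show ?thesis using c by (simp add: c_def)
  qed
  define N where "N = CARD('n) * card S"
  have "card (S \<times> (UNIV :: 'n set)) = N" by (simp add: N_def card_cartesian_product)
  then obtain h where h: "bij_betw h {..<N} (S \<times> (UNIV :: 'n set))"
    using ex_bij_betw_nat_finite[of "S \<times> (UNIV :: 'n set)"] S by (auto simp: atLeast0LessThan)
  have hS: "h k \<in> S \<times> UNIV" if "k < N" for k using h that by (auto simp: bij_betw_def)
  define f where "f = (\<lambda>k x. g (h k) x - c)"
  have f_pos: "0 < f k (\<theta> T) \<longleftrightarrow> 0 < g (h k) (\<theta> T)" if "T \<subseteq> S" "k < N" for k T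
    using c_less[OF that(1) hS[OF that(2)]] c by (auto simp: f_def)
  define pat where "pat = (\<lambda>T. {k\<in>{..<N}. 0 < f k (\<theta> T)})"
  have inj: "inj_on pat (Pow S)"
  \<comment> \<open>A subset is read off its pattern: \<open>q\<close> lies in \<open>T\<close>
    exactly when some minor of \<open>q\<close> fails to be positive.\<close>
  proof (rule inj_on_inverseI[where g = "\<lambda>W. {q\<in>S. \<exists>k<N. fst (h k) = q \<and> k \<notin> W}"])
    fix T assume "T \<in> Pow S"
    then have T: "T \<subseteq> S" by simp
    have "q \<in> T \<longleftrightarrow> (\<exists>k<N. fst (h k) = q \<and> k \<notin> pat T)" if q: "q \<in> S" for q
    proof
      assume "q \<in> T"
      then obtain i where i: "\<not> 0 < g (q, i) (\<theta> T)" using pd_minors[OF T q] by blast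
      have "(q, i) \<in> h ` {..<N}" using h q by (simp add: bij_betw_def)
      then obtain k where "k < N" "h k = (q, i)" by auto
      then show "\<exists>k<N. fst (h k) = q \<and> k \<notin> pat T"
        using i f_pos[OF T] by (intro exI[of _ k]) (simp add: pat_def)
    next
      assume "\<exists>k<N. fst (h k) = q \<and> k \<notin> pat T"
      then obtain k where "k < N" "fst (h k) = q" "\<not> 0 < f k (\<theta> T)" by (auto simp: pat_def)
      then have "\<not> 0 < g (q, snd (h k)) (\<theta> T)" using f_pos[OF T] by auto
      then show "q \<in> T" using pd_minors[OF T q] by blast
    qed
    then show "{q\<in>S. \<exists>k<N. fst (h k) = q \<and> k \<notin> pat T} = T" using T by blast
  qed
  have "card (pat ` Pow S) \<le> (2 * (CARD('n) * 2) + 1) ^ CARD('m)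
      * (\<Sum>k\<le>CARD('m). (card {..<N} choose k) * 2 ^ k)"
  proof (rule card_sign_patterns_le)
    show "poly_deg_le (CARD('n) * 2) (f k)" if "k \<in> {..<N}" for k
      using that unfolding f_def by (intro poly_deg_le_diff_const g_deg hS) simp
    show "pat ` Pow S \<subseteq> Pow {..<N}" by (auto simp: pat_def)
    fix W assume "W \<in> pat ` Pow S"
    then obtain T where T: "T \<subseteq> S" "W = pat T" by auto
    have "f k (\<theta> T) < 0" if "k \<in> {..<N} - pat T" for k
    proof -
      have k: "k < N" "\<not> 0 < f k (\<theta> T)" using that by (auto simp: pat_def)
      then have "\<not> 0 < g (h k) (\<theta> T)" using f_pos[OF T(1) k(1)] by simp
      then show ?thesis using c by (simp add: f_def)
    qed
    then show "\<exists>x. (\<forall>i\<in>W. 0 < f i x) \<and> (\<forall>i\<in>{..<N} - W. f i x < 0)"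
      using T by (intro exI[of _ "\<theta> T"]) (auto simp: pat_def)
  qed simp
  moreover have "card (pat ` Pow S) = 2 ^ card S"
    using inj S by (simp add: card_image card_Pow)
  ultimately have "2 ^ card S \<le> (4 * CARD('n) + 1) ^ CARD('m)
      * (\<Sum>k\<le>CARD('m). (CARD('n) * card S choose k) * (2::nat) ^ k)"
    by (simp add: N_def mult.commute)
  then show ?thesis by (intro pattern_count_imp_bound) (auto simp: Suc_le_eq)
qed

section \<open>From shattered sets to the VC-dimension in the two settings\<close>

text \<open>A nonempty family shatters the empty set, so the cardinalities form a nonempty finite
  set and the supremum in \<open>enat\<close> is an attained maximum.\<close>

lemma VC_dim_bounded:
  assumes "G \<noteq> {}" and bound: "\<And>S. shattered_by G Q S \<Longrightarrow> real (card S) \<le> B"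
  shows "\<exists>d::nat. VC_dim G Q = enat d \<and> real d \<le> B"
proof -
  define X where "X = {card S | S. shattered_by G Q S}"
  have "shattered_by G Q {}" using assms(1) by (auto simp: shattered_by_def)
  then have ne: "0 \<in> X" unfolding X_def by (metis (mono_tags, lifting) card.empty mem_Collect_eq)
  have "X \<subseteq> {..nat \<lfloor>B\<rfloor>}"
    unfolding X_def using bound by (auto simp: le_nat_floor)
  then have fin: "finite X" by (rule finite_subset) simp
  have Max: "Max X \<in> X" using fin ne by (intro Max_in) auto
  have "{enat (card S) | S. shattered_by G Q S} = enat ` X" by (auto simp: X_def)
  then have "VC_dim G Q = Sup (enat ` X)" by (simp add: VC_dim_def)
  also have "\<dots> = enat (Max X)"
    using fin Max by (intro cSup_eq_maximum) auto
  finally have "VC_dim G Q = enat (Max X)" .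
  moreover have "real (Max X) \<le> B" using Max bound unfolding X_def by auto
  ultimately show ?thesis by blast
qed

lemma psd_indicator_eq_1_iff: "psd_indicator A = 1 \<longleftrightarrow> \<not> psd A"
  by (simp add: psd_indicator_def)

lemma VC_dim_psd_indicator:
  fixes F :: "real^'m::finite \<Rightarrow> 'q \<Rightarrow> real^'n::finite^'n"
  assumes sym: "\<And>\<theta> q. q \<in> Q \<Longrightarrow> sym_mat (F \<theta> q)"
    and deg: "\<And>q i j. q \<in> Q \<Longrightarrow> poly_deg_le 2 (\<lambda>\<theta>. F \<theta> q $ i $ j)"
  shows "\<exists>d::nat. VC_dim {(\<lambda>q. psd_indicator (F \<theta> q)) | \<theta>. True} Q = enat d \<and>
    real d \<le> 2 * real CARD('m) * log 2 (4 * exp 1 * real CARD('n) * 2 ^ CARD('n))"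
proof (rule VC_dim_bounded)
  fix S assume S: "shattered_by {(\<lambda>q. psd_indicator (F \<theta> q)) | \<theta>. True} Q S"
  then have SQ: "S \<subseteq> Q" and fin: "finite S" by (simp_all add: shattered_by_def)
  show "real (card S) \<le> 2 * real CARD('m) * log 2 (4 * exp 1 * real CARD('n) * 2 ^ CARD('n))"
  proof (rule card_psd_shattered_le[where F = F])
    show "sym_mat (F \<theta> q)" if "q \<in> S" for \<theta> q using that SQ by (intro sym) blast
    show "poly_deg_le 2 (\<lambda>\<theta>. F \<theta> q $ i $ j)" if "q \<in> S" for q i j
      using that SQ by (intro deg) blast
    fix T assume "T \<subseteq> S"
    then obtain h where h: "h \<in> {(\<lambda>q. psd_indicator (F \<theta> q)) | \<theta>. True}" "{q\<in>S. h q = 1} = T"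
      using S unfolding shattered_by_def by meson
    from h(1) obtain \<theta> where "h = (\<lambda>q. psd_indicator (F \<theta> q))" by auto
    with h(2) have "{q\<in>S. \<not> psd (F \<theta> q)} = T" by (simp only: psd_indicator_eq_1_iff)
    then show "\<exists>\<theta>. {q\<in>S. \<not> psd (F \<theta> q)} = T" by (rule exI)
  qed (fact fin)
qed auto

lemma sym_mat_iff: "sym_mat A \<longleftrightarrow> (\<forall>i j. A $ i $ j = A $ j $ i)"
  by (auto simp: sym_mat_def transpose_def vec_eq_iff)

lemma poly_deg_le_coeff_var: "k \<ge> 1 \<Longrightarrow> poly_deg_le k (\<lambda>x. x $ i * c)"
  using poly_deg_le.var_mult[OF poly_deg_le.const[of 0 c], of i] poly_deg_le_mono by fastforce

lemma poly_deg_le_coeff_var2: "poly_deg_le 2 (\<lambda>x. x $ i * x $ j * c)"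
  using poly_deg_le.var_mult[OF poly_deg_le.var_mult[OF poly_deg_le.const[of 0 c], of j], of i]
  by (simp add: numeral_2_eq_2 mult.assoc)

theorem theorem3:
  fixes Q :: "(real^'l::finite) set"
  shows
  "(\<forall>(F0 :: real^'l \<Rightarrow> real^'n::finite^'n) (Fs :: 'mx::finite \<Rightarrow> real^'l \<Rightarrow> real^'n^'n).
      (\<forall>q\<in>Q. sym_mat (F0 q) \<and> (\<forall>i. sym_mat (Fs i q))) \<longrightarrow>
      (\<exists>d::nat. VC_dim {(\<lambda>q. psd_indicator (lmi_F F0 Fs x q)) | x. True} Q = enat d \<and>
         real d \<le> 2 * real CARD('mx) * log 2 (4 * exp 1 * real CARD('n) * 2 ^ CARD('n))))
   \<and>
   (\<forall>(F0 :: real^'l \<Rightarrow> real^'n^'n) (Fs :: 'mx \<Rightarrow> real^'l \<Rightarrow> real^'n^'n)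
      (Gs :: 'my::finite \<Rightarrow> real^'l \<Rightarrow> real^'n^'n) (Hs :: 'mx \<Rightarrow> 'my \<Rightarrow> real^'l \<Rightarrow> real^'n^'n).
      (\<forall>q\<in>Q. sym_mat (F0 q) \<and> (\<forall>i. sym_mat (Fs i q)) \<and> (\<forall>j. sym_mat (Gs j q))
              \<and> (\<forall>i j. sym_mat (Hs i j q))) \<longrightarrow>
      (\<exists>d::nat. VC_dim {(\<lambda>q. psd_indicator (bmi_F F0 Fs Gs Hs x y q)) | x y. True} Q = enat d \<and>
         real d \<le> 2 * real (CARD('mx) + CARD('my))
                     * log 2 (4 * exp 1 * real CARD('n) * 2 ^ CARD('n))))"
proof (intro conjI allI impI)
  fix F0 :: "real^'l \<Rightarrow> real^'n^'n" and Fs :: "'mx \<Rightarrow> real^'l \<Rightarrow> real^'n^'n"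
  assume sym: "\<forall>q\<in>Q. sym_mat (F0 q) \<and> (\<forall>i. sym_mat (Fs i q))"
  show "\<exists>d::nat. VC_dim {(\<lambda>q. psd_indicator (lmi_F F0 Fs x q)) | x. True} Q = enat d \<and>
         real d \<le> 2 * real CARD('mx) * log 2 (4 * exp 1 * real CARD('n) * 2 ^ CARD('n))"
  proof (rule VC_dim_psd_indicator)
    fix x q assume q: "q \<in> Q"
    have "F0 q $ i $ j = F0 q $ j $ i" "Fs k q $ i $ j = Fs k q $ j $ i" for i j k
      using sym q unfolding sym_mat_iff by blast+
    then show "sym_mat (lmi_F F0 Fs x q)"
      by (simp add: sym_mat_iff lmi_F_def)
  next
    fix q :: "real^'l" and i j
    have "poly_deg_le 2 (\<lambda>x. F0 q $ i $ j + (\<Sum>k\<in>UNIV. x $ k * Fs k q $ i $ j))"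
      by (intro poly_deg_le.add poly_deg_le.const poly_deg_le_sum poly_deg_le_coeff_var) simp
    then show "poly_deg_le 2 (\<lambda>x. lmi_F F0 Fs x q $ i $ j)"
      by (simp add: lmi_F_def)
  qed
next
  fix F0 :: "real^'l \<Rightarrow> real^'n^'n" and Fs :: "'mx \<Rightarrow> real^'l \<Rightarrow> real^'n^'n"
    and Gs :: "'my \<Rightarrow> real^'l \<Rightarrow> real^'n^'n" and Hs :: "'mx \<Rightarrow> 'my \<Rightarrow> real^'l \<Rightarrow> real^'n^'n"
  assume sym: "\<forall>q\<in>Q. sym_mat (F0 q) \<and> (\<forall>i. sym_mat (Fs i q)) \<and> (\<forall>j. sym_mat (Gs j q))
              \<and> (\<forall>i j. sym_mat (Hs i j q))"
  \<comment> \<open>\<open>x\<close> and \<open>y\<close> are joined into one vector indexed by the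
    sum type, whose cardinality is the sum of both dimensions.\<close>
  define F where "F = (\<lambda>(z :: real^('mx + 'my)) q.
    bmi_F F0 Fs Gs Hs (\<chi> i. z $ Inl i) (\<chi> j. z $ Inr j) q)"
  have "\<exists>z. x = (\<chi> i. z $ Inl i) \<and> y = (\<chi> j. z $ Inr j)" for x :: "real^'mx" and y :: "real^'my"
    by (intro exI[of _ "\<chi> k. case k of Inl i \<Rightarrow> x $ i | Inr j \<Rightarrow> y $ j"]) (simp add: vec_eq_iff)
  then have family: "{(\<lambda>q. psd_indicator (bmi_F F0 Fs Gs Hs x y q)) | x y. True}
      = {(\<lambda>q. psd_indicator (F z q)) | z. True}"
    unfolding F_def by (intro Collect_cong iffI; elim exE conjE; metis)
  have "\<exists>d::nat. VC_dim {(\<lambda>q. psd_indicator (F z q)) | z. True} Q = enat d \<and>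
    real d \<le> 2 * real CARD('mx + 'my) * log 2 (4 * exp 1 * real CARD('n) * 2 ^ CARD('n))"
  proof (rule VC_dim_psd_indicator)
    fix z q assume q: "q \<in> Q"
    have "F0 q $ i $ j = F0 q $ j $ i" "Fs k q $ i $ j = Fs k q $ j $ i"
      "Gs l q $ i $ j = Gs l q $ j $ i" "Hs k l q $ i $ j = Hs k l q $ j $ i" for i j k l
      using sym q unfolding sym_mat_iff by blast+
    then show "sym_mat (F z q)"
      by (simp add: sym_mat_iff F_def bmi_F_def)
  next
    fix q :: "real^'l" and i j
    have "poly_deg_le 2 (\<lambda>z :: real^('mx + 'my). F0 q $ i $ j + (\<Sum>k\<in>UNIV. z $ Inl k * Fs k q $ i $ j)
       + (\<Sum>l\<in>UNIV. z $ Inr l * Gs l q $ i $ j)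
       + (\<Sum>k\<in>UNIV. \<Sum>l\<in>UNIV. z $ Inl k * z $ Inr l * Hs k l q $ i $ j))"
      by (intro poly_deg_le.add poly_deg_le.const poly_deg_le_sum poly_deg_le_coeff_var
          poly_deg_le_coeff_var2) simp_all
    then show "poly_deg_le 2 (\<lambda>z. F z q $ i $ j)"
      by (simp add: F_def bmi_F_def)
  qed
  then show "\<exists>d::nat. VC_dim {(\<lambda>q. psd_indicator (bmi_F F0 Fs Gs Hs x y q)) | x y. True} Q = enat d \<and>
         real d \<le> 2 * real (CARD('mx) + CARD('my))
                     * log 2 (4 * exp 1 * real CARD('n) * 2 ^ CARD('n))"
    unfolding family by simp
qed

end
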